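(* Let $d\ge 1$ be a real number and $r\ge 1$ a natural number. If a finite simple graph $G$ has an $r$-robust average degree $\ge d$, then \[ \lambda_2(G) \ge 2\sqrt{d-1}\cos\left(\frac{\pi}{r+1}\right). \]
   Context: For a vertex $v$ of $G$ and $r\in\mathbb{N}$, the ball of radius $r$ centered at $v$ is the induced subgraph of $G$ on the vertices at distance at most $r$ from $v$. A graph $G$ has an $r$-robust average degree $\ge d$ if, for every vertex $v$, the graph obtained from $G$ by deleting all vertices of the ball of radius $r$ centered at $v$ has average degree (twice the number of edges divided by the number of vertices) at least $d$. $\lambda_2(G)$ denotes the second largest eigenvalue of the adjacency matrix of $G$. *)

theory Defs
  imports
    "HOL-Computational_Algebra.Polynomial"
    "Jordan_Normal_Form.Char_Poly"
    "Graph_Theory.Digraph_Component"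
    "Graph_Theory.Shortest_Path"
begin

text \<open>
  A finite simple graph is an instance of the locale \<^locale>\<open>graph\<close>: a finite symmetric digraph without
  loops and parallel arcs. Each undirected edge is represented by two opposite arcs, hence the
  passage to unordered pairs when edges are counted.
\<close>

definition edge_set :: "('a, 'b) pre_digraph \<Rightarrow> 'a set set" where
  "edge_set G = {{u, v} | u v. (u, v) \<in> arcs_ends G}"

text \<open>
  For the graph without vertices the quotient below is \<open>x / 0 = 0\<close>, so that graph does not satisfy
  \<open>average_degree G \<ge> d\<close> for any \<open>d > 0\<close>.
\<close>

definition average_degree :: "('a, 'b) pre_digraph \<Rightarrow> real" where
  "average_degree G = 2 * real (card (edge_set G)) / real (card (verts G))"

text \<open>
  With unit weights, the cost of a cheapest walk is the graph distance; it is \<open>\<infinity>\<close> between vertices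
  in different components.
\<close>

definition graph_dist :: "('a, 'b) pre_digraph \<Rightarrow> 'a \<Rightarrow> 'a \<Rightarrow> ereal" where
  "graph_dist G u v = wf_digraph.\<mu> G (\<lambda>_. 1) u v"

definition graph_ball :: "('a, 'b) pre_digraph \<Rightarrow> 'a \<Rightarrow> nat \<Rightarrow> ('a, 'b) pre_digraph" where
  "graph_ball G v r = G \<restriction> {u \<in> verts G. graph_dist G v u \<le> ereal (real r)}"

definition robust_average_degree_ge :: "('a, 'b) pre_digraph \<Rightarrow> nat \<Rightarrow> real \<Rightarrow> bool" where
  "robust_average_degree_ge G r d \<longleftrightarrow>
     (\<forall>v \<in> verts G. average_degree (G \<restriction> (verts G - verts (graph_ball G v r))) \<ge> d)"

definition adjacency_matrix :: "('a, 'b) pre_digraph \<Rightarrow> 'a list \<Rightarrow> real mat" where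
  "adjacency_matrix G vs =
     mat (length vs) (length vs) (\<lambda>(i, j). if (vs ! i, vs ! j) \<in> arcs_ends G then 1 else 0)"

text \<open>
  Matrices are indexed by natural numbers, so the vertices have to be enumerated. Another enumeration
  conjugates the adjacency matrix by a permutation matrix and leaves its eigenvalues unchanged.
\<close>

definition vertex_enumeration :: "('a, 'b) pre_digraph \<Rightarrow> 'a list" where
  "vertex_enumeration G = (SOME vs. distinct vs \<and> set vs = verts G)"

text \<open>
  The eigenvalues in descending order \<open>\<lambda>\<^sub>1 \<ge> \<lambda>\<^sub>2 \<ge> \<dots>\<close>, repeated according to their multiplicity as
  roots of the characteristic polynomial.
\<close>

definition graph_eigenvalues :: "('a, 'b) pre_digraph \<Rightarrow> real list" where
  "graph_eigenvalues G =
     rev (sorted_list_of_multiset (proots (char_poly (adjacency_matrix G (vertex_enumeration G)))))"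

text \<open>The list is indexed from 0; the value is meaningful only for graphs with at least two vertices.\<close>

definition lambda2 :: "('a, 'b) pre_digraph \<Rightarrow> real" where
  "lambda2 G = graph_eigenvalues G ! 1"

end

theory Submission
  imports Defs "HOL-Analysis.L2_Norm"
begin

text \<open>
  Put \<open>c = 2 sqrt (d - 1) cos (pi / (r + 1))\<close>. A graph of average degree at least \<open>d\<close> has a vertex \<open>v\<close> and
  a nonzero vector with Rayleigh quotient at least \<open>c\<close> that is supported within distance \<open>r - 1\<close> of \<open>v\<close>:
  give \<open>u\<close> the square root of \<open>\<Sum>\<^sub>i g\<^sub>i\<^sup>2 P(X\<^sub>i = u)\<close>, where \<open>X\<close> is the non-backtracking random walk from \<open>v\<close>
  and \<open>g\<close> the top eigenvector of the path on \<open>r\<close> vertices. When \<open>v\<close> is averaged with weights proportional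
  to the degrees, the walk is stationary and the estimate reduces to the convexity of \<open>x sqrt (x - 1)\<close>.

  Apply this to the graph that remains after deleting some ball of radius \<open>r\<close>, and then delete the
  ball of radius \<open>r\<close> around \<open>v\<close>. The indicator vector of what is left has Rayleigh quotient at least \<open>d \<ge> c\<close>,
  and no edge joins it to the support of the first vector. So the quadratic form of the adjacency
  matrix is at least \<open>c\<close> times the squared norm on a plane, which forces \<open>\<lambda>\<^sub>2 \<ge> c\<close>.
\<close>

section \<open>Eigenvalues of real symmetric matrices\<close>

lemma adjoint_scalar_prod:
  fixes A :: "real mat"
  assumes "A \<in> carrier_mat n n" "A\<^sup>T = A" "x \<in> carrier_vec n" "y \<in> carrier_vec n"
  shows "x \<bullet> (A *\<^sub>v y) = (A *\<^sub>v x) \<bullet> y"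
  using transpose_vec_mult_scalar[of A n n y x] assms by simp

text \<open>Moving the matrix across the product of an eigenvector \<open>v\<close> with
  \<open>conjugate v\<close> evaluates it both as \<open>a\<close> and as \<open>cnj a\<close> times
  the nonzero number \<open>v \<bullet> conjugate v\<close>.\<close>

lemma symmetric_real_eigenvalues:
  fixes A :: "real mat" and a :: complex
  assumes A: "A \<in> carrier_mat n n" and sym: "A\<^sup>T = A"
    and ev: "eigenvalue (map_mat complex_of_real A) a"
  shows "a \<in> \<real>"
proof -
  let ?C = "map_mat complex_of_real A"
  have C: "?C \<in> carrier_mat n n" using A by simp
  have CT: "?C\<^sup>T = ?C" using sym by (metis map_mat_transpose)
  from ev obtain v where v: "v \<in> carrier_vec n" "v \<noteq> 0\<^sub>v n" and Cv: "?C *\<^sub>v v = a \<cdot>\<^sub>v v"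
    unfolding eigenvalue_def eigenvector_def using A by auto
  have cv: "conjugate v \<in> carrier_vec n" using v by simp
  have "?C *\<^sub>v conjugate v = conjugate (?C *\<^sub>v v)"
    using C v by (intro eq_vecI) (auto simp: scalar_prod_def sum_conjugate conjugate_dist_mul)
  also have "\<dots> = conjugate a \<cdot>\<^sub>v conjugate v"
    unfolding Cv by (rule conjugate_smult_vec)
  finally have Ccv: "?C *\<^sub>v conjugate v = conjugate a \<cdot>\<^sub>v conjugate v" .
  have "a * (v \<bullet> conjugate v) = (?C *\<^sub>v v) \<bullet> conjugate v"
    unfolding Cv using v by simp
  also have "\<dots> = v \<bullet> (?C *\<^sub>v conjugate v)"
    using transpose_vec_mult_scalar[OF C cv v(1)] CT by simp
  also have "\<dots> = cnj a * (v \<bullet> conjugate v)"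
    unfolding Ccv using v by simp
  finally have "a = cnj a" using conjugate_square_eq_0_vec[OF v(1)] v(2) by simp
  then show ?thesis by (metis Reals_cnj_iff)
qed

text \<open>All complex roots are real, so the complex factorization is the image of a real one, and
  the embedding of real into complex polynomials is injective.\<close>

lemma symmetric_char_poly_splits:
  fixes A :: "real mat"
  assumes A: "A \<in> carrier_mat n n" and sym: "A\<^sup>T = A"
  obtains es where "char_poly A = (\<Prod>e\<leftarrow>es. [:- e, 1:])" "length es = n"
proof -
  let ?C = "map_mat complex_of_real A"
  have C: "?C \<in> carrier_mat n n" using A by simp
  obtain as where as: "char_poly ?C = (\<Prod>a\<leftarrow>as. [:- a, 1:])" "length as = n"
    using char_poly_factorized[OF C] by blast
  interpret h: map_poly_inj_idom_hom complex_of_real ..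
  have real: "complex_of_real (Re a) = a" if "a \<in> set as" for a
  proof -
    have "eigenvalue ?C a"
      unfolding eigenvalue_root_char_poly[OF C] as using that
      by (auto simp: poly_prod_list prod_list_zero_iff)
    then show ?thesis using symmetric_real_eigenvalues[OF A sym] by simp
  qed
  have "map_poly complex_of_real (char_poly A) = (\<Prod>a\<leftarrow>as. [:- a, 1:])"
    using of_real_hom.char_poly_hom[OF A, where 'a=complex] as by simp
  also have "\<dots> = (\<Prod>a\<leftarrow>as. [:- complex_of_real (Re a), 1:])"
    using real by (intro arg_cong[where f=prod_list] map_cong) auto
  also have "\<dots> = map_poly complex_of_real (\<Prod>e\<leftarrow>map Re as. [:- e, 1:])"
    by (simp add: h.hom_prod_list o_def)
  finally have "char_poly A = (\<Prod>e\<leftarrow>map Re as. [:- e, 1:])" by simp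
  then show ?thesis using as(2) by (intro that[of "map Re as"]) auto
qed

text \<open>The reflection in the hyperplane orthogonal to \<open>v - unit_vec n 0\<close> exchanges
  these two vectors because they have equal length.\<close>

lemma householder_reflection:
  fixes v :: "real vec"
  assumes v: "v \<in> carrier_vec n" and n: "0 < n" and unit: "v \<bullet> v = 1"
  obtains W where "W \<in> carrier_mat n n" "W\<^sup>T = W" "W * W = 1\<^sub>m n" "W *\<^sub>v unit_vec n 0 = v"
proof (cases "v = unit_vec n 0")
  case True
  then show ?thesis using that[of "1\<^sub>m n"] v n by simp
next
  case False
  define w where "w = v - unit_vec n 0"
  have w: "w \<in> carrier_vec n" using v by (simp add: w_def)
  define s where "s = w \<bullet> w"
  have "w \<noteq> 0\<^sub>v n"
  proof
    assume "w = 0\<^sub>v n"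
    then have "v $ i = unit_vec n 0 $ i" if "i < n" for i
      using that v by (auto simp: w_def dest!: arg_cong[where f="\<lambda>u. u $ i"])
    then show False using False v by (auto intro: eq_vecI)
  qed
  then have s0: "s \<noteq> 0"
    using conjugate_square_eq_0_vec[OF w] by (simp add: s_def)
  have "s = v \<bullet> v - 2 * v $ 0 + 1"
    using v n unfolding s_def w_def
    by (simp add: minus_scalar_prod_distrib scalar_prod_minus_distrib
        scalar_prod_left_unit scalar_prod_right_unit)
  \<comment> \<open>Since \<open>v\<close> is a unit vector, \<open>s = 2 - 2 * v $ 0\<close>. Hence
    \<open>c * w $ 0 = -1\<close>, and the reflection adds exactly \<open>w\<close> to the first
    basis vector.\<close>
  then have s: "s = - 2 * w $ 0"
    using v n unit by (simp add: w_def)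
  define c where "c = 2 / s"
  define W where "W = mat n n (\<lambda>(i, j). (if i = j then 1 else 0) - c * w $ i * w $ j)"
  have W: "W \<in> carrier_mat n n" by (simp add: W_def)
  have WT: "W\<^sup>T = W" by (intro eq_matI) (auto simp: W_def)
  have sum_s: "(\<Sum>k = 0..<n. w $ k * w $ k) = s"
    using w by (simp add: s_def scalar_prod_def)
  have "W * W = 1\<^sub>m n"
  proof (intro eq_matI)
    fix i j assume ij: "i < dim_row (1\<^sub>m n :: real mat)" "j < dim_col (1\<^sub>m n :: real mat)"
    have "(W * W) $$ (i, j) = (\<Sum>k = 0..<n. ((if i = k then 1 else 0) - c * w $ i * w $ k)
       * ((if k = j then 1 else 0) - c * w $ k * w $ j))"
      using ij by (simp add: W_def scalar_prod_def)
    also have "\<dots> = (\<Sum>k = 0..<n. (if k = i then (if i = j then 1 else 0) - c * w $ i * w $ j else 0)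
       - (if k = j then c * w $ i * w $ j else 0)
       + (c\<^sup>2 * w $ i * w $ j) * (w $ k * w $ k))"
      by (intro sum.cong refl) (auto simp: algebra_simps power2_eq_square)
    also have "\<dots> = (if i = j then 1 else 0) - c * w $ i * w $ j - c * w $ i * w $ j
       + (c\<^sup>2 * w $ i * w $ j) * s"
      unfolding sum.distrib sum_subtractf sum_distrib_left[symmetric] sum_s
      using ij by simp
    also have "\<dots> = 1\<^sub>m n $$ (i, j)"
      using ij s0 by (simp add: c_def power2_eq_square)
    finally show "(W * W) $$ (i, j) = 1\<^sub>m n $$ (i, j)" .
  qed (use W in auto)
  moreover have "W *\<^sub>v unit_vec n 0 = v"
  proof (intro eq_vecI)
    fix i assume "i < dim_vec v"
    then have i: "i < n" using v by simp
    have "(W *\<^sub>v unit_vec n 0) $ i = (if i = 0 then 1 else 0) - c * w $ i * w $ 0"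
      using i n W by (simp add: W_def scalar_prod_right_unit)
    also have "\<dots> = (if i = 0 then 1 else 0) + w $ i"
      using s s0 by (simp add: c_def field_simps)
    also have "\<dots> = v $ i" using v n i by (auto simp: w_def)
    finally show "(W *\<^sub>v unit_vec n 0) $ i = v $ i" .
  qed (use W v in auto)
  ultimately show ?thesis using that W WT by blast
qed

text \<open>Conjugation by a reflection that takes the unit eigenvector \<open>v\<close> to the
  first basis vector leaves a block diagonal matrix with blocks \<open>e\<close> and
  \<open>B\<close>. The vector \<open>y\<close> is the reflected \<open>x\<close> without its first
  coordinate, which equals \<open>v \<bullet> x\<close>.\<close>

lemma symmetric_deflation:
  fixes A :: "real mat"
  assumes A: "A \<in> carrier_mat (Suc n) (Suc n)" and sym: "A\<^sup>T = A" and ev: "eigenvalue A e"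
  obtains v B where "v \<in> carrier_vec (Suc n)" "B \<in> carrier_mat n n" "B\<^sup>T = B"
    "char_poly A = [:- e, 1:] * char_poly B"
    "\<And>x. x \<in> carrier_vec (Suc n) \<Longrightarrow> \<exists>y \<in> carrier_vec n.
       x \<bullet> (A *\<^sub>v x) = e * (v \<bullet> x)\<^sup>2 + y \<bullet> (B *\<^sub>v y) \<and> x \<bullet> x = (v \<bullet> x)\<^sup>2 + y \<bullet> y"
proof -
  let ?m = "Suc n"
  from ev obtain u where u: "u \<in> carrier_vec ?m" "u \<noteq> 0\<^sub>v ?m" and Au: "A *\<^sub>v u = e \<cdot>\<^sub>v u"
    unfolding eigenvalue_def eigenvector_def using A by auto
  have upos: "u \<bullet> u > 0"
    using conjugate_square_eq_0_vec[OF u(1)] u(2) conjugate_square_ge_0_vec[of u] by simp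
  define v where "v = (1 / sqrt (u \<bullet> u)) \<cdot>\<^sub>v u"
  have v: "v \<in> carrier_vec ?m" using u by (simp add: v_def)
  have Av: "A *\<^sub>v v = e \<cdot>\<^sub>v v"
    using A u Au by (simp add: v_def mult_mat_vec smult_smult_assoc mult.commute)
  have unit: "v \<bullet> v = 1"
    using u upos by (simp add: v_def field_simps)
  obtain W where W: "W \<in> carrier_mat ?m ?m" and WT: "W\<^sup>T = W" and WW: "W * W = 1\<^sub>m ?m"
    and We: "W *\<^sub>v unit_vec ?m 0 = v"
    using householder_reflection[OF v _ unit] by blast
  have Wv: "W *\<^sub>v v = unit_vec ?m 0"
    unfolding We[symmetric]
    using assoc_mult_mat_vec[OF W W, of "unit_vec ?m 0"] by (simp add: WW)
  define C where "C = W * (A * W)"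
  have C: "C \<in> carrier_mat ?m ?m" using A W by (simp add: C_def)
  have CT: "C\<^sup>T = C"
  proof -
    have "C\<^sup>T = (A * W)\<^sup>T * W\<^sup>T"
      unfolding C_def by (rule transpose_mult[OF W mult_carrier_mat[OF A W]])
    also have "\<dots> = (W * A) * W" by (simp add: transpose_mult[OF A W] WT sym)
    also have "\<dots> = C" unfolding C_def by (rule assoc_mult_mat[OF W A W])
    finally show ?thesis .
  qed
  have "C *\<^sub>v unit_vec ?m 0 = W *\<^sub>v (A *\<^sub>v (W *\<^sub>v unit_vec ?m 0))"
    using A W by (simp add: C_def assoc_mult_mat_vec[of _ ?m ?m _ ?m])
  also have "\<dots> = e \<cdot>\<^sub>v unit_vec ?m 0"
    using W v by (simp add: We Av mult_mat_vec Wv)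
  finally have Ce: "C *\<^sub>v unit_vec ?m 0 = e \<cdot>\<^sub>v unit_vec ?m 0" .
  have col0: "C $$ (i, 0) = (if i = 0 then e else 0)" if "i < ?m" for i
    using arg_cong[OF Ce, of "\<lambda>x. x $ i"] that C by (simp add: scalar_prod_right_unit)
  have row0: "C $$ (0, i) = (if i = 0 then e else 0)" if "i < ?m" for i
    using col0[OF that] CT C that by (metis carrier_matD index_transpose_mat(1) zero_less_Suc)
  define B where "B = mat n n (\<lambda>(i, j). C $$ (Suc i, Suc j))"
  have B: "B \<in> carrier_mat n n" by (simp add: B_def)
  have BT: "B\<^sup>T = B"
  proof (intro eq_matI)
    fix i j assume "i < dim_row B" "j < dim_col B"
    then show "B\<^sup>T $$ (i, j) = B $$ (i, j)"
      using C arg_cong[OF CT, of "\<lambda>M. M $$ (Suc i, Suc j)"] by (simp add: B_def)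
  qed (use B in auto)
  let ?E = "mat 1 1 (\<lambda>_. e)"
  have block: "C = four_block_mat ?E (0\<^sub>m 1 n) (0\<^sub>m n 1) B"
    using C by (intro eq_matI) (auto simp: B_def col0 row0 less_Suc_eq_0_disj)
  have "similar_mat_wit A C W W"
    by (rule similar_mat_witI[of _ _ ?m])
      (use A W C WW in \<open>auto simp: C_def assoc_mult_mat[of _ ?m ?m _ ?m _ ?m]
         assoc_mult_mat[of W ?m ?m W ?m _ ?m, symmetric]\<close>)
  then have "char_poly A = char_poly C"
    by (intro char_poly_similar) (auto simp: similar_mat_def)
  also have "\<dots> = char_poly ?E * char_poly B"
    unfolding block by (rule char_poly_four_block_zeros_col) (use B in auto)
  also have "char_poly ?E = [:- e, 1:]"
    by (simp add: char_poly_defs det_def sign_def)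
  finally have cp: "char_poly A = [:- e, 1:] * char_poly B" .
  have split: "\<exists>y \<in> carrier_vec n.
       x \<bullet> (A *\<^sub>v x) = e * (v \<bullet> x)\<^sup>2 + y \<bullet> (B *\<^sub>v y) \<and> x \<bullet> x = (v \<bullet> x)\<^sup>2 + y \<bullet> y"
    if x: "x \<in> carrier_vec ?m" for x
  proof -
    define z where "z = W *\<^sub>v x"
    have z: "z \<in> carrier_vec ?m" using W x by (simp add: z_def)
    have xz: "x = W *\<^sub>v z"
      using assoc_mult_mat_vec[OF W W x] x by (simp add: WW z_def)
    define a where "a = vec 1 (\<lambda>_. z $ 0)"
    define y where "y = vec n (\<lambda>i. z $ Suc i)"
    have a: "a \<in> carrier_vec 1" and y: "y \<in> carrier_vec n" by (simp_all add: a_def y_def)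
    have zay: "z = a @\<^sub>v y"
      using z by (intro eq_vecI) (auto simp: a_def y_def)
    have "z $ 0 = unit_vec ?m 0 \<bullet> z" using z by (simp add: scalar_prod_left_unit)
    also have "\<dots> = v \<bullet> x"
      unfolding z_def We[symmetric] by (rule adjoint_scalar_prod[OF W WT _ x]) simp
    finally have z0: "z $ 0 = v \<bullet> x" .
    have "x \<bullet> x = z \<bullet> (W *\<^sub>v (W *\<^sub>v z))"
      using adjoint_scalar_prod[OF W WT z, of "W *\<^sub>v z"] xz x by simp
    also have "W *\<^sub>v (W *\<^sub>v z) = z" using xz z_def by simp
    also have "z \<bullet> z = a \<bullet> a + y \<bullet> y"
      unfolding zay by (rule scalar_prod_append[OF a y a y])
    also have "a \<bullet> a = (v \<bullet> x)\<^sup>2" by (simp add: a_def scalar_prod_def z0 power2_eq_square)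
    finally have 1: "x \<bullet> x = (v \<bullet> x)\<^sup>2 + y \<bullet> y" .
    have "x \<bullet> (A *\<^sub>v x) = z \<bullet> (W *\<^sub>v (A *\<^sub>v (W *\<^sub>v z)))"
      using adjoint_scalar_prod[OF W WT z, of "A *\<^sub>v x"] xz x A by simp
    also have "W *\<^sub>v (A *\<^sub>v (W *\<^sub>v z)) = C *\<^sub>v z"
      using A W z by (simp add: C_def assoc_mult_mat_vec[of _ ?m ?m _ ?m])
    also have "C *\<^sub>v z = (?E *\<^sub>v a) @\<^sub>v (B *\<^sub>v y)"
      unfolding zay block by (rule mult_mat_vec_split) (use B a y in auto)
    also have "z \<bullet> \<dots> = a \<bullet> (?E *\<^sub>v a) + y \<bullet> (B *\<^sub>v y)"
      unfolding zay
      by (rule scalar_prod_append[OF a y mult_mat_vec_carrier[OF mat_carrier a] mult_mat_vec_carrier[OF B y]])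
    also have "a \<bullet> (?E *\<^sub>v a) = e * (v \<bullet> x)\<^sup>2"
      by (simp add: a_def scalar_prod_def z0 power2_eq_square)
    finally show ?thesis using 1 y by blast
  qed
  show ?thesis using that[OF v B BT cp split] by blast
qed

text \<open>Each deflation splits off one eigenvalue times a square, so by induction the form is a
  sum of squares with coefficients at most \<open>c\<close>.\<close>

lemma rayleigh_quotient_le:
  fixes A :: "real mat"
  assumes "A \<in> carrier_mat n n" "A\<^sup>T = A" "char_poly A = (\<Prod>e\<leftarrow>es. [:- e, 1:])"
    "\<And>e. e \<in> set es \<Longrightarrow> e \<le> c" "x \<in> carrier_vec n"
  shows "x \<bullet> (A *\<^sub>v x) \<le> c * (x \<bullet> x)"
  using assms
proof (induction es arbitrary: A n x)
  case Nil
  then have "n = 0" using degree_monic_char_poly[OF Nil(1)] by simp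
  then show ?case using Nil by (simp add: scalar_prod_def)
next
  case (Cons e es)
  have "n \<noteq> 0"
  proof
    assume "n = 0"
    then have "char_poly A = 1" using degree_monic_char_poly[OF Cons.prems(1)]
      by (metis degree_eq_zeroE coeff_pCons_0 one_pCons)
    moreover have "poly (char_poly A) e = 0" using Cons.prems(3) by simp
    ultimately show False by simp
  qed
  then obtain m where n: "n = Suc m" by (cases n) auto
  have "eigenvalue A e"
    using Cons.prems(3) by (simp add: eigenvalue_root_char_poly[OF Cons.prems(1)])
  then obtain v B where v: "v \<in> carrier_vec n" and B: "B \<in> carrier_mat m m" "B\<^sup>T = B"
    and cp: "char_poly A = [:- e, 1:] * char_poly B"
    and split: "\<And>x. x \<in> carrier_vec n \<Longrightarrow> \<exists>y \<in> carrier_vec m.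
       x \<bullet> (A *\<^sub>v x) = e * (v \<bullet> x)\<^sup>2 + y \<bullet> (B *\<^sub>v y) \<and> x \<bullet> x = (v \<bullet> x)\<^sup>2 + y \<bullet> y"
    using symmetric_deflation[of A m e] Cons.prems(1,2) n by metis
  have cpB: "char_poly B = (\<Prod>e\<leftarrow>es. [:- e, 1:])"
    using cp Cons.prems(3) by (simp del: mult_pCons_left)
  obtain y where y: "y \<in> carrier_vec m" and
    "x \<bullet> (A *\<^sub>v x) = e * (v \<bullet> x)\<^sup>2 + y \<bullet> (B *\<^sub>v y)" "x \<bullet> x = (v \<bullet> x)\<^sup>2 + y \<bullet> y"
    using split[OF Cons.prems(5)] by (elim bexE conjE)
  moreover have "y \<bullet> (B *\<^sub>v y) \<le> c * (y \<bullet> y)"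
    using Cons.IH[OF B cpB _ y] Cons.prems(4) by simp
  moreover have "e * (v \<bullet> x)\<^sup>2 \<le> c * (v \<bullet> x)\<^sup>2"
    using Cons.prems(4) by (intro mult_right_mono) auto
  ultimately show ?case by (simp add: distrib_left)
qed

text \<open>One half of Courant-Fischer: the plane meets the hyperplane orthogonal to a top
  eigenvector, and there the form is that of the deflated matrix, whose largest eigenvalue is the
  second one of \<open>A\<close>.\<close>

lemma second_eigenvalue_ge:
  fixes A :: "real mat" and c :: real
  assumes A: "A \<in> carrier_mat n n" and sym: "A\<^sup>T = A" and n: "n \<ge> 2"
    and xy: "x \<in> carrier_vec n" "y \<in> carrier_vec n"
    and pos: "\<And>a b. a \<noteq> 0 \<or> b \<noteq> 0 \<Longrightarrow>
      (a \<cdot>\<^sub>v x + b \<cdot>\<^sub>v y) \<bullet> (a \<cdot>\<^sub>v x + b \<cdot>\<^sub>v y) > 0"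
    and ge: "\<And>a b. (a \<cdot>\<^sub>v x + b \<cdot>\<^sub>v y) \<bullet> (A *\<^sub>v (a \<cdot>\<^sub>v x + b \<cdot>\<^sub>v y))
      \<ge> c * ((a \<cdot>\<^sub>v x + b \<cdot>\<^sub>v y) \<bullet> (a \<cdot>\<^sub>v x + b \<cdot>\<^sub>v y))"
  shows "rev (sorted_list_of_multiset (proots (char_poly A))) ! 1 \<ge> c"
proof -
  obtain es0 where es0: "char_poly A = (\<Prod>e\<leftarrow>es0. [:- e, 1:])" "length es0 = n"
    using symmetric_char_poly_splits[OF A sym] .
  have roots: "proots (char_poly A) = mset es0"
  proof -
    have "0 \<notin> set (map (\<lambda>e. [:- e, 1:]) es0)" by auto
    then show ?thesis unfolding es0
      by (induction es0) (auto simp: proots_mult prod_list_zero_iff simp del: mult_pCons_left)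
  qed
  define es where "es = rev (sort es0)"
  have es: "rev (sorted_list_of_multiset (proots (char_poly A))) = es"
    by (simp add: roots es_def sorted_list_of_multiset_mset)
  have "mset es = mset es0" by (simp add: es_def)
  then have "char_poly A = (\<Prod>e\<leftarrow>es. [:- e, 1:])"
    unfolding es0(1) by (metis mset_map prod_mset_prod_list)
  moreover obtain e0 e1 rest where es_eq: "es = e0 # e1 # rest"
    using n es0(2) \<open>mset es = mset es0\<close>
    by (metis Suc_le_length_iff mset_eq_length numeral_2_eq_2)
  ultimately have cpA: "char_poly A = [:- e0, 1:] * (\<Prod>e\<leftarrow>e1 # rest. [:- e, 1:])" by simp
  have le: "e \<le> e1" if "e \<in> set (e1 # rest)" for e
  proof -
    have "sorted (rev es)" by (simp add: es_def)
    then show ?thesis using that by (auto simp: es_eq sorted_append)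
  qed
  obtain m where m: "n = Suc m" using n by (cases n) auto
  have "eigenvalue A e0"
    using cpA by (simp add: eigenvalue_root_char_poly[OF A])
  then obtain v B where v: "v \<in> carrier_vec n" and B: "B \<in> carrier_mat m m" "B\<^sup>T = B"
    and cp: "char_poly A = [:- e0, 1:] * char_poly B"
    and split: "\<And>x. x \<in> carrier_vec n \<Longrightarrow> \<exists>y \<in> carrier_vec m.
       x \<bullet> (A *\<^sub>v x) = e0 * (v \<bullet> x)\<^sup>2 + y \<bullet> (B *\<^sub>v y) \<and> x \<bullet> x = (v \<bullet> x)\<^sup>2 + y \<bullet> y"
    using symmetric_deflation[of A m e0] A sym m by metis
  have cpB: "char_poly B = (\<Prod>e\<leftarrow>e1 # rest. [:- e, 1:])"
    using cp cpA by (metis mult_cancel_left pCons_eq_0_iff zero_neq_one)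
  \<comment> \<open>One linear equation in two unknowns has a nonzero solution, so some nonzero
    vector of the plane is orthogonal to \<open>v\<close>.\<close>
  obtain a b where ab: "a \<noteq> 0 \<or> b \<noteq> 0" "a * (v \<bullet> x) + b * (v \<bullet> y) = 0"
  proof (cases "v \<bullet> x = 0")
    case True
    then show ?thesis using that[of 1 0] by simp
  next
    case False
    then show ?thesis using that[of "- (v \<bullet> y)" "v \<bullet> x"] by simp
  qed
  define z where "z = a \<cdot>\<^sub>v x + b \<cdot>\<^sub>v y"
  have z: "z \<in> carrier_vec n" using xy by (simp add: z_def)
  have "v \<bullet> z = 0"
    using ab(2) v xy by (simp add: z_def scalar_prod_add_distrib[of _ n])
  then obtain w where w: "w \<in> carrier_vec m" "z \<bullet> (A *\<^sub>v z) = w \<bullet> (B *\<^sub>v w)" "z \<bullet> z = w \<bullet> w"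
    using split[OF z] by auto
  have "c * (z \<bullet> z) \<le> e1 * (z \<bullet> z)"
    using ge[of a b] rayleigh_quotient_le[OF B cpB le w(1)] w(2,3) unfolding z_def by simp
  moreover have "z \<bullet> z > 0" using pos[OF ab(1)] by (simp add: z_def)
  ultimately have "c \<le> e1" by simp
  then show ?thesis unfolding es by (simp add: es_eq)
qed

section \<open>Non-backtracking walks\<close>

text \<open>The sum runs over ordered pairs, so each edge counts twice, as in the quadratic form of
  the adjacency matrix.\<close>

definition quad_form :: "'a set \<Rightarrow> ('a \<Rightarrow> 'a \<Rightarrow> bool) \<Rightarrow> ('a \<Rightarrow> real) \<Rightarrow> real" where
  "quad_form S E f = (\<Sum>u\<in>S. \<Sum>w\<in>{w \<in> S. E u w}. f u * f w)"

definition degree_in :: "'a set \<Rightarrow> ('a \<Rightarrow> 'a \<Rightarrow> bool) \<Rightarrow> 'a \<Rightarrow> real" where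
  "degree_in S E u = real (card {w \<in> S. E u w})"

text \<open>The ball of radius \<open>i\<close> around \<open>v\<close> with respect to walks that
  stay inside \<open>S\<close>.\<close>

fun reach :: "'a set \<Rightarrow> ('a \<Rightarrow> 'a \<Rightarrow> bool) \<Rightarrow> 'a \<Rightarrow> nat \<Rightarrow> 'a set" where
  "reach S E v 0 = {v}"
| "reach S E v (Suc i) = reach S E v i \<union> {w \<in> S. \<exists>u \<in> reach S E v i. E u w}"

lemma reach_mono: "i \<le> j \<Longrightarrow> reach S E v i \<subseteq> reach S E v j"
  by (induction j) (auto simp: le_Suc_eq)

lemma reach_subset: "v \<in> S \<Longrightarrow> reach S E v i \<subseteq> S"
  by (induction i) auto

lemma reach_mono_set: "S \<subseteq> T \<Longrightarrow> reach S E v i \<subseteq> reach T E v i"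
  by (induction i) auto

text \<open>The top eigenvector of the path on \<open>R + 1\<close> vertices.\<close>

definition path_weight :: "nat \<Rightarrow> nat \<Rightarrow> real" where
  "path_weight R i = sin ((real i + 1) * pi / (real R + 2))"

lemma path_weight_pos:
  assumes "i \<le> R"
  shows "path_weight R i > 0"
  unfolding path_weight_def
proof (rule sin_gt_zero)
  show "0 < (real i + 1) * pi / (real R + 2)" by simp
  have "(real i + 1) * pi < pi * (real R + 2)" using assms by simp
  then show "(real i + 1) * pi / (real R + 2) < pi" by (simp add: divide_less_eq)
qed

text \<open>The sines satisfy a three-term recurrence with factor \<open>2 * cos t\<close> and
  vanish just beyond both ends of the path. This is the eigenvalue equation, here multiplied by the
  eigenvector and summed.\<close>

lemma path_weight_sum:
  "2 * (\<Sum>i<R. path_weight R i * path_weight R (Suc i))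
     = 2 * cos (pi / (real R + 2)) * (\<Sum>i\<le>R. (path_weight R i)\<^sup>2)"
proof -
  define t where "t = pi / (real R + 2)"
  \<comment> \<open>The shift by one puts the zero boundary values at the indices 0 and
    \<open>R + 2\<close>.\<close>
  define h where "h k = sin (real k * t)" for k
  have pw: "path_weight R i = h (Suc i)" for i
    by (simp add: path_weight_def h_def t_def add.commute)
  have h0: "h 0 = 0" by (simp add: h_def)
  have hR: "h (Suc (Suc R)) = 0"
  proof -
    have "real (Suc (Suc R)) * t = pi" by (simp add: t_def field_simps)
    then show ?thesis by (simp add: h_def)
  qed
  have rec: "2 * cos t * h (Suc k) = h k + h (Suc (Suc k))" for k
  proof -
    have "h k = sin (real (Suc k) * t - t)" "h (Suc (Suc k)) = sin (real (Suc k) * t + t)"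
      by (simp_all add: h_def algebra_simps)
    then show ?thesis by (simp add: h_def sin_add sin_diff)
  qed
  have "2 * cos t * (\<Sum>i\<le>R. (h (Suc i))\<^sup>2) = (\<Sum>i\<le>R. (2 * cos t * h (Suc i)) * h (Suc i))"
    by (simp add: sum_distrib_left power2_eq_square mult.assoc)
  also have "\<dots> = (\<Sum>i\<le>R. h i * h (Suc i)) + (\<Sum>i\<le>R. h (Suc i) * h (Suc (Suc i)))"
    unfolding rec by (simp add: algebra_simps sum.distrib)
  also have "(\<Sum>i\<le>R. h i * h (Suc i)) = (\<Sum>i<R. h (Suc i) * h (Suc (Suc i)))"
    by (simp add: h0 lessThan_Suc_atMost[symmetric] sum.lessThan_Suc_shift del: sum.lessThan_Suc)
  also have "(\<Sum>i\<le>R. h (Suc i) * h (Suc (Suc i))) = (\<Sum>i<R. h (Suc i) * h (Suc (Suc i)))"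
    by (simp add: lessThan_Suc_atMost[symmetric] hR)
  finally show ?thesis by (simp add: pw t_def)
qed

lemma cos_pi_div_nonneg: "0 \<le> cos (pi / (real R + 2))"
proof (rule cos_ge_zero)
  show "pi / (real R + 2) \<le> pi / 2" by (intro divide_left_mono) auto
  have "- (pi / 2) \<le> 0" by simp
  also have "0 \<le> pi / (real R + 2)" by simp
  finally show "- (pi / 2) \<le> pi / (real R + 2)" .
qed

text \<open>AM-GM for \<open>d - 1\<close> and 1, together with \<open>cos \<le> 1\<close>. It makes
  indicator vectors, whose Rayleigh quotient is an average degree, good enough as test
  vectors.\<close>

lemma two_sqrt_pred_cos_le:
  assumes "1 \<le> d"
  shows "2 * sqrt (d - 1) * cos (pi / (real R + 2)) \<le> d"
proof -
  have "2 * sqrt (d - 1) \<le> d"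
    using arith_geo_mean_sqrt[of "d - 1" 1] assms by simp
  then have "2 * sqrt (d - 1) * cos (pi / (real R + 2)) \<le> d * 1"
    using assms by (intro mult_mono cos_pi_div_nonneg) auto
  then show ?thesis by simp
qed

text \<open>The tangent line of \<open>x sqrt (x - 1)\<close> at \<open>x = d\<close> has slope \<open>sqrt (d - 1) + d / (2 sqrt (d - 1))\<close>.\<close>

lemma mult_sqrt_pred_tangent:
  fixes x d :: real
  assumes "x \<ge> 1" "d \<ge> 2"
  shows "x * sqrt (x - 1) \<ge> x * sqrt (d - 1) + d / (2 * sqrt (d - 1)) * (x - d)"
proof -
  define s where "s = sqrt (d - 1)"
  define t where "t = sqrt (x - 1)"
  have s: "s \<ge> 1" "d = s\<^sup>2 + 1" and t: "t \<ge> 0" "x = t\<^sup>2 + 1"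
    using assms by (auto simp: s_def t_def)
  have "s * t \<ge> 0" "s\<^sup>2 \<ge> 1" using s t by (auto simp: one_le_power)
  \<comment> \<open>The difference of the two sides, multiplied by \<open>2 * s\<close>, factors in
    this way. The bound \<open>d \<ge> 2\<close> means \<open>s \<ge> 1\<close>, which keeps the
    second factor nonnegative for every \<open>t \<ge> 0\<close>.\<close>
  then have "0 \<le> (t - s)\<^sup>2 * (2 * s * t + s\<^sup>2 - 1)" by (intro mult_nonneg_nonneg) auto
  also have "\<dots> = 2 * s * (x * t - x * s) - d * (x - d)"
    unfolding s(2) t(2) by (simp add: algebra_simps power2_eq_square)
  finally have "d * (x - d) \<le> (x * t - x * s) * (2 * s)" by (simp add: ac_simps)
  then have "d * (x - d) / (2 * s) \<le> x * t - x * s"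
    using s(1) by (simp add: pos_divide_le_eq)
  then show ?thesis by (simp add: s_def t_def)
qed

text \<open>The relation \<open>E\<close> lives on the whole type and may leave \<open>S\<close>, so
  passing to an induced subgraph changes only the set.\<close>

locale finite_simple_graph =
  fixes S :: "'a set" and E :: "'a \<Rightarrow> 'a \<Rightarrow> bool"
  assumes fin: "finite S"
    and sym: "E u w \<Longrightarrow> E w u"
    and irrefl: "\<not> E u u"
begin

abbreviation nbrs :: "'a \<Rightarrow> 'a set" where
  "nbrs u \<equiv> {w \<in> S. E u w}"

abbreviation deg :: "'a \<Rightarrow> real" where
  "deg \<equiv> degree_in S E"

text \<open>
  For the non-backtracking random walk \<open>X\<^sub>0 = v, X\<^sub>1, X\<^sub>2, \<dots>\<close>, \<open>step_prob i v u w\<close> is the probability of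
  \<open>X\<^sub>i = u\<close> and \<open>X\<^sub>i\<^sub>+\<^sub>1 = w\<close>, and \<open>visit_prob i v u\<close> is that of \<open>X\<^sub>i = u\<close>.
\<close>

fun step_prob :: "nat \<Rightarrow> 'a \<Rightarrow> 'a \<Rightarrow> 'a \<Rightarrow> real" where
  "step_prob 0 v u w = (if u = v \<and> E u w then 1 / deg v else 0)"
| "step_prob (Suc i) v u w =
     (if E u w then (\<Sum>t\<in>nbrs u - {w}. step_prob i v t u) / (deg u - 1) else 0)"

fun visit_prob :: "nat \<Rightarrow> 'a \<Rightarrow> 'a \<Rightarrow> real" where
  "visit_prob 0 v u = (if u = v then 1 else 0)"
| "visit_prob (Suc i) v u = (\<Sum>t\<in>nbrs u. step_prob i v t u)"

lemma sum_adjacent_swap: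
  "(\<Sum>u\<in>S. \<Sum>w\<in>nbrs u. f u w) = (\<Sum>u\<in>S. \<Sum>w\<in>nbrs u. (f w u :: real))"
proof -
  have "(\<Sum>u\<in>S. \<Sum>w\<in>nbrs u. f u w) = (\<Sum>u\<in>S. \<Sum>w\<in>S. if E u w then f u w else 0)"
    by (simp add: sum.inter_filter fin)
  also have "\<dots> = (\<Sum>w\<in>S. \<Sum>u\<in>S. if E u w then f u w else 0)" by (rule sum.swap)
  also have "\<dots> = (\<Sum>w\<in>S. \<Sum>u\<in>S. if E w u then f u w else 0)"
    by (intro sum.cong refl) (auto dest: sym)
  also have "\<dots> = (\<Sum>u\<in>S. \<Sum>w\<in>nbrs u. f w u)"
    by (simp add: sum.inter_filter fin)
  finally show ?thesis .
qed

text \<open>A walk that has entered a vertex of degree at least 2 can leave it by another edge, so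
  \<open>deg u - 1\<close> is a legitimate divisor.\<close>

context
  assumes min_degree: "\<And>u. u \<in> S \<Longrightarrow> deg u \<ge> 2"
begin

section \<open>Support and stationarity of the non-backtracking walk\<close>

lemma step_prob_nonneg: "u \<in> S \<Longrightarrow> v \<in> S \<Longrightarrow> 0 \<le> step_prob i v u w"
proof (induction i arbitrary: u w)
  case 0
  then show ?case using min_degree[of v] by simp
next
  case (Suc i)
  then show ?case using min_degree[of u]
    by (auto intro!: divide_nonneg_nonneg sum_nonneg)
qed

lemma visit_prob_nonneg: "u \<in> S \<Longrightarrow> v \<in> S \<Longrightarrow> 0 \<le> visit_prob i v u"
  by (cases i) (auto intro!: sum_nonneg step_prob_nonneg)

lemma step_prob_support: "v \<in> S \<Longrightarrow> u \<in> S \<Longrightarrow> step_prob i v u w \<noteq> 0 \<Longrightarrow> u \<in> reach S E v i"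
proof (induction i arbitrary: u w)
  case 0
  then show ?case by (simp split: if_splits)
next
  case (Suc i)
  then have "(\<Sum>t\<in>nbrs u - {w}. step_prob i v t u) \<noteq> 0" by (auto split: if_splits)
  then obtain t where "t \<in> nbrs u - {w}" "step_prob i v t u \<noteq> 0" by (rule sum.not_neutral_contains_not_neutral)
  then show ?case using Suc by (auto dest: sym)
qed

lemma visit_prob_support: "v \<in> S \<Longrightarrow> u \<in> S \<Longrightarrow> visit_prob i v u \<noteq> 0 \<Longrightarrow> u \<in> reach S E v i"
proof (cases i)
  case 0
  then show "visit_prob i v u \<noteq> 0 \<Longrightarrow> u \<in> reach S E v i" by (simp split: if_splits)
next
  case (Suc j)
  assume *: "v \<in> S" "u \<in> S" "visit_prob i v u \<noteq> 0"
  then have "(\<Sum>t\<in>nbrs u. step_prob j v t u) \<noteq> 0" using Suc by simp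
  then obtain t where "t \<in> nbrs u" "step_prob j v t u \<noteq> 0" by (rule sum.not_neutral_contains_not_neutral)
  then show ?thesis using step_prob_support[of v t j u] * Suc by (auto dest: sym)
qed

lemma visit_prob_0_split:
  assumes "u \<in> S" "v \<in> S" "E u w"
  shows "visit_prob 0 v u = deg u * step_prob 0 v u w"
  using assms min_degree[of v] by auto

text \<open>A walk at \<open>u\<close> came either from \<open>w\<close> or from another neighbour;
  in the second case it moves on to \<open>w\<close> with probability
  \<open>1 / (deg u - 1)\<close>.\<close>

lemma visit_prob_Suc_split:
  assumes "u \<in> S" "w \<in> S" "E u w"
  shows "visit_prob (Suc i) v u = (deg u - 1) * step_prob (Suc i) v u w + step_prob i v w u"
proof -
  have "visit_prob (Suc i) v u = step_prob i v w u + (\<Sum>t\<in>nbrs u - {w}. step_prob i v t u)"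
    using assms fin by (simp add: sum.remove[of _ w])
  then show ?thesis using assms min_degree[of u] by simp
qed

text \<open>With start weights \<open>deg v\<close> every arc carries mass 1 at every step: the arc
  from \<open>u\<close> to \<open>w\<close> receives the share \<open>1 / (deg u - 1)\<close> of
  each of the \<open>deg u - 1\<close> unit masses entering \<open>u\<close> from elsewhere.\<close>

lemma step_prob_stationary:
  "u \<in> S \<Longrightarrow> w \<in> S \<Longrightarrow> E u w \<Longrightarrow> (\<Sum>v\<in>S. deg v * step_prob i v u w) = 1"
proof (induction i arbitrary: u w)
  case 0
  have "(\<Sum>v\<in>S. deg v * step_prob 0 v u w) = (\<Sum>v\<in>S. if v = u then 1 else 0)"
    using 0 min_degree by (intro sum.cong refl) (auto dest: min_degree)
  then show ?case using 0 fin by simp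
next
  case (Suc i)
  have card: "real (card (nbrs u - {w})) = deg u - 1"
    using Suc.prems fin min_degree[of u] by (simp add: degree_in_def card_Diff_singleton of_nat_diff)
  have "(\<Sum>v\<in>S. deg v * step_prob (Suc i) v u w)
      = (\<Sum>v\<in>S. \<Sum>t\<in>nbrs u - {w}. deg v * step_prob i v t u) / (deg u - 1)"
    using Suc.prems by (simp add: sum_distrib_left sum_divide_distrib)
  also have "(\<Sum>v\<in>S. \<Sum>t\<in>nbrs u - {w}. deg v * step_prob i v t u)
      = (\<Sum>t\<in>nbrs u - {w}. \<Sum>v\<in>S. deg v * step_prob i v t u)" by (rule sum.swap)
  also have "\<dots> = (\<Sum>t\<in>nbrs u - {w}. 1)"
    using Suc.prems by (intro sum.cong refl Suc.IH) (auto dest: sym)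
  also have "\<dots> = deg u - 1" using card by simp
  finally show ?case using min_degree[of u] Suc.prems by simp
qed

lemma visit_prob_stationary:
  assumes "u \<in> S"
  shows "(\<Sum>v\<in>S. deg v * visit_prob i v u) = deg u"
proof (cases i)
  case 0
  have "(\<Sum>v\<in>S. deg v * visit_prob 0 v u) = (\<Sum>v\<in>S. if v = u then deg u else 0)"
    by (intro sum.cong refl) auto
  then show ?thesis using 0 assms fin by simp
next
  case (Suc j)
  have "(\<Sum>v\<in>S. deg v * visit_prob i v u) = (\<Sum>t\<in>nbrs u. \<Sum>v\<in>S. deg v * step_prob j v t u)"
    unfolding Suc visit_prob.simps sum_distrib_left by (rule sum.swap)
  also have "\<dots> = (\<Sum>t\<in>nbrs u. 1)"
    using assms by (intro sum.cong refl step_prob_stationary) (auto dest: sym)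
  finally show ?thesis by (simp add: degree_in_def)
qed

section \<open>Walk vectors and their average Rayleigh quotient\<close>

definition walk_vector :: "nat \<Rightarrow> 'a \<Rightarrow> 'a \<Rightarrow> real" where
  "walk_vector R v u = sqrt (\<Sum>i\<le>R. (path_weight R i)\<^sup>2 * visit_prob i v u)"

text \<open>
  Cauchy-Schwarz for the walks ending in \<open>u\<close> against those ending in \<open>w\<close>: a walk is matched with its
  extension by one step along the edge, or with its truncation if its last step used the edge.
\<close>

lemma walk_vector_edge:
  assumes uw: "u \<in> S" "w \<in> S" "E u w" and v: "v \<in> S"
  shows "walk_vector R v u * walk_vector R v w \<ge>
    (\<Sum>i<R. path_weight R i * path_weight R (Suc i) *
       (sqrt (deg u - 1) * step_prob i v u w + sqrt (deg w - 1) * step_prob i v w u))"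
proof -
  define g where "g = path_weight R"
  have g: "g i \<ge> 0" if "i \<le> R" for i using path_weight_pos[OF that] by (simp add: g_def)
  \<comment> \<open>With \<open>True\<close> the entry comes from crossings from \<open>u\<close> to
    \<open>w\<close> at step \<open>i\<close>; with \<open>False\<close> it comes from crossings
    from \<open>w\<close> to \<open>u\<close> at that step, which put the walk at \<open>u\<close>
    at time \<open>i + 1\<close>. In \<open>Y\<close> the ends and the flag are exchanged, so both
    factors of a product concern the same crossing.\<close>
  define X where "X u w = (\<lambda>(i, b). if b then g i * sqrt ((deg u - 1) * step_prob i v u w)
     else g (Suc i) * sqrt (step_prob i v w u))" for u w
  define Y where "Y = (\<lambda>(i, b). X w u (i, \<not> b))"
  let ?I = "{..<R} \<times> {True, False}"
  have sum_I: "(\<Sum>p\<in>?I. f p) = (\<Sum>i<R. f (i, True) + f (i, False))" for f :: "nat \<times> bool \<Rightarrow> real"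
    by (simp add: sum.cartesian_product')
  have bound: "(\<Sum>i<R. (X u w (i, True))\<^sup>2 + (X u w (i, False))\<^sup>2)
      \<le> (\<Sum>i\<le>R. (g i)\<^sup>2 * visit_prob i v u)" if uw: "u \<in> S" "w \<in> S" "E u w" for u w
  proof -
    have d: "deg u \<ge> 2" using min_degree uw by simp
    have nn: "0 \<le> step_prob i v u w" "0 \<le> step_prob i v w u" for i
      using uw v step_prob_nonneg by auto
    define a where "a i = (g i)\<^sup>2 * ((deg u - 1) * step_prob i v u w)" for i
    define b where "b i = (g (Suc i))\<^sup>2 * step_prob i v w u" for i
    have a0: "0 \<le> a i" for i using d nn by (simp add: a_def)
    have "(\<Sum>i<R. (X u w (i, True))\<^sup>2 + (X u w (i, False))\<^sup>2) = (\<Sum>i<R. a i + b i)"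
      using d nn by (simp add: X_def power_mult_distrib a_def b_def)
    \<comment> \<open>Adding \<open>a R\<close> permits a regrouping by the time at which the walk
      is at \<open>u\<close>: \<open>a (Suc i)\<close> and \<open>b i\<close> both belong to time
      \<open>Suc i\<close> and together give its weighted visit probability. At time 0 only an
      inequality holds, with \<open>deg u - 1\<close> in place of \<open>deg u\<close>.\<close>
    also have "\<dots> \<le> (\<Sum>i\<le>R. a i) + (\<Sum>i<R. b i)"
      using a0 by (simp add: sum.distrib lessThan_Suc_atMost[symmetric])
    also have "\<dots> = a 0 + (\<Sum>i<R. a (Suc i) + b i)"
      by (simp add: lessThan_Suc_atMost[symmetric] sum.lessThan_Suc_shift sum.distrib del: sum.lessThan_Suc)
    also have "\<dots> \<le> (g 0)\<^sup>2 * visit_prob 0 v u + (\<Sum>i<R. (g (Suc i))\<^sup>2 * visit_prob (Suc i) v u)"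
    proof (intro add_mono sum_mono)
      show "a 0 \<le> (g 0)\<^sup>2 * visit_prob 0 v u"
        unfolding a_def visit_prob_0_split[OF uw(1) v uw(3)]
        using nn(1)[of 0] by (intro mult_left_mono mult_right_mono) auto
      show "a (Suc i) + b i \<le> (g (Suc i))\<^sup>2 * visit_prob (Suc i) v u" for i
        unfolding a_def b_def visit_prob_Suc_split[OF uw] by (simp only: distrib_left)
    qed
    also have "\<dots> = (\<Sum>i\<le>R. (g i)\<^sup>2 * visit_prob i v u)"
      by (simp add: lessThan_Suc_atMost[symmetric] sum.lessThan_Suc_shift del: sum.lessThan_Suc visit_prob.simps)
    finally show ?thesis .
  qed
  have du: "deg u \<ge> 2" "deg w \<ge> 2" using min_degree uw by auto
  have nn: "0 \<le> step_prob i v u w" "0 \<le> step_prob i v w u" for i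
    using uw v step_prob_nonneg by auto
  have mm: "sqrt (c * p) * sqrt p = sqrt c * p" if "p \<ge> 0" for c p
    using that by (simp add: real_sqrt_mult)
  have summand: "X u w (i, True) * Y (i, True) + X u w (i, False) * Y (i, False) = g i * g (Suc i) *
       (sqrt (deg u - 1) * step_prob i v u w + sqrt (deg w - 1) * step_prob i v w u)" for i
  proof -
    have "X u w (i, True) * Y (i, True) = g i * g (Suc i) * (sqrt (deg u - 1) * step_prob i v u w)"
      using mm[OF nn(1)[of i], of "deg u - 1"] by (simp add: X_def Y_def ac_simps)
    moreover have "X u w (i, False) * Y (i, False) = g i * g (Suc i) * (sqrt (deg w - 1) * step_prob i v w u)"
      using mm[OF nn(2)[of i], of "deg w - 1"] by (simp add: X_def Y_def ac_simps)
    ultimately show ?thesis by (simp add: distrib_left)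
  qed
  have "(\<Sum>i<R. g i * g (Suc i) *
       (sqrt (deg u - 1) * step_prob i v u w + sqrt (deg w - 1) * step_prob i v w u))
     = (\<Sum>p\<in>?I. X u w p * Y p)"
    unfolding sum_I summand ..
  also have "\<dots> \<le> (\<Sum>p\<in>?I. \<bar>X u w p\<bar> * \<bar>Y p\<bar>)"
    by (intro sum_mono) (metis abs_ge_self abs_mult)
  also have "\<dots> \<le> L2_set (X u w) ?I * L2_set Y ?I" by (rule L2_set_mult_ineq)
  also have "\<dots> \<le> walk_vector R v u * walk_vector R v w"
  proof (rule mult_mono)
    show "L2_set (X u w) ?I \<le> walk_vector R v u"
    unfolding L2_set_def walk_vector_def sum_I g_def[symmetric]
    by (intro real_sqrt_le_mono bound uw)
    show "L2_set Y ?I \<le> walk_vector R v w"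
    using bound[OF uw(2,1) sym[OF uw(3)]]
    unfolding L2_set_def walk_vector_def sum_I g_def[symmetric] Y_def
    by (intro real_sqrt_le_mono) (simp add: add.commute)
    show "0 \<le> walk_vector R v u"
      unfolding walk_vector_def using uw v
      by (intro real_sqrt_ge_zero sum_nonneg mult_nonneg_nonneg visit_prob_nonneg) auto
  qed simp
  finally show ?thesis unfolding g_def .
qed

lemma walk_vector_norm:
  assumes v: "v \<in> S" and u: "u \<in> S"
  shows "(walk_vector R v u)\<^sup>2 = (\<Sum>i\<le>R. (path_weight R i)\<^sup>2 * visit_prob i v u)"
  unfolding walk_vector_def
  by (intro real_sqrt_pow2 sum_nonneg mult_nonneg_nonneg visit_prob_nonneg) (use assms in auto)

lemma walk_vector_weighted_norm:
  "(\<Sum>v\<in>S. deg v * (\<Sum>u\<in>S. (walk_vector R v u)\<^sup>2)) = (\<Sum>i\<le>R. (path_weight R i)\<^sup>2) * (\<Sum>u\<in>S. deg u)"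
proof -
  have "(\<Sum>v\<in>S. deg v * (\<Sum>u\<in>S. (walk_vector R v u)\<^sup>2))
      = (\<Sum>v\<in>S. \<Sum>u\<in>S. \<Sum>i\<le>R. (path_weight R i)\<^sup>2 * (deg v * visit_prob i v u))"
    by (simp add: walk_vector_norm sum_distrib_left ac_simps)
  also have "\<dots> = (\<Sum>u\<in>S. \<Sum>v\<in>S. \<Sum>i\<le>R. (path_weight R i)\<^sup>2 * (deg v * visit_prob i v u))"
    by (rule sum.swap)
  also have "\<dots> = (\<Sum>u\<in>S. \<Sum>i\<le>R. \<Sum>v\<in>S. (path_weight R i)\<^sup>2 * (deg v * visit_prob i v u))"
    by (intro sum.cong refl sum.swap)
  also have "\<dots> = (\<Sum>u\<in>S. \<Sum>i\<le>R. (path_weight R i)\<^sup>2 * deg u)"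
    by (simp add: sum_distrib_left[symmetric] visit_prob_stationary)
  finally show ?thesis by (simp only: sum_distrib_left sum_distrib_right)
qed

text \<open>Summed over the starts, the edge estimate gives an arc from \<open>u\<close> to
  \<open>w\<close> the amount \<open>sqrt (deg u - 1) + sqrt (deg w - 1)\<close> for each step. A
  vertex \<open>u\<close> is the tail of \<open>deg u\<close> arcs and the head of as many, whence
  the factor 2.\<close>

lemma walk_vector_weighted_quad_form:
  "(\<Sum>v\<in>S. deg v * quad_form S E (walk_vector R v))
     \<ge> 2 * (\<Sum>i<R. path_weight R i * path_weight R (Suc i)) * (\<Sum>u\<in>S. deg u * sqrt (deg u - 1))"
proof -
  define G where "G i = path_weight R i * path_weight R (Suc i)" for i
  let ?s = "\<lambda>u. sqrt (deg u - 1)"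
  let ?t = "\<lambda>i v u w. G i * (?s u * (deg v * step_prob i v u w) + ?s w * (deg v * step_prob i v w u))"
  have "2 * (\<Sum>i<R. G i) * (\<Sum>u\<in>S. deg u * ?s u)
      = (\<Sum>i<R. G i) * ((\<Sum>u\<in>S. \<Sum>w\<in>nbrs u. ?s u) + (\<Sum>u\<in>S. \<Sum>w\<in>nbrs u. ?s w))"
    using sum_adjacent_swap[of "\<lambda>u w. ?s w"] by (simp add: degree_in_def)
  also have "\<dots> = (\<Sum>u\<in>S. \<Sum>w\<in>nbrs u. (\<Sum>i<R. G i) * (?s u + ?s w))"
    by (simp only: sum_distrib_left sum.distrib[symmetric] distrib_left)
  \<comment> \<open>By stationarity each coefficient 1 is expanded into a degree-weighted sum over
    the starts \<open>v\<close>.\<close>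
  also have "\<dots> = (\<Sum>u\<in>S. \<Sum>w\<in>nbrs u. \<Sum>i<R. \<Sum>v\<in>S. ?t i v u w)"
  proof (intro sum.cong refl)
    fix u w assume uw: "u \<in> S" "w \<in> nbrs u"
    have "(\<Sum>v\<in>S. ?t i v u w) = G i * (?s u + ?s w)" for i
    proof -
      have "(\<Sum>v\<in>S. ?t i v u w) = G i * (?s u * (\<Sum>v\<in>S. deg v * step_prob i v u w)
          + ?s w * (\<Sum>v\<in>S. deg v * step_prob i v w u))"
        by (simp only: sum_distrib_left sum.distrib distrib_left)
      then show ?thesis
        using uw step_prob_stationary[of u w i] step_prob_stationary[of w u i] sym[of u w]
        by (simp del: step_prob.simps)
    qed
    then show "(\<Sum>i<R. G i) * (?s u + ?s w) = (\<Sum>i<R. \<Sum>v\<in>S. ?t i v u w)"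
      by (simp add: sum_distrib_right)
  qed
  also have "\<dots> = (\<Sum>u\<in>S. \<Sum>w\<in>nbrs u. \<Sum>v\<in>S. \<Sum>i<R. ?t i v u w)"
    by (intro sum.cong refl sum.swap)
  also have "\<dots> = (\<Sum>u\<in>S. \<Sum>v\<in>S. \<Sum>w\<in>nbrs u. \<Sum>i<R. ?t i v u w)"
    by (intro sum.cong refl sum.swap)
  also have "\<dots> = (\<Sum>v\<in>S. \<Sum>u\<in>S. \<Sum>w\<in>nbrs u. \<Sum>i<R. ?t i v u w)"
    by (rule sum.swap)
  also have "\<dots> = (\<Sum>v\<in>S. deg v * (\<Sum>u\<in>S. \<Sum>w\<in>nbrs u. \<Sum>i<R.
      G i * (?s u * step_prob i v u w + ?s w * step_prob i v w u)))"
    by (simp only: sum_distrib_left distrib_left mult.left_commute[of "deg _"] mult.left_commute[of "G _" "deg _"])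
  also have "\<dots> \<le> (\<Sum>v\<in>S. deg v * quad_form S E (walk_vector R v))"
    unfolding quad_form_def G_def
    by (intro sum_mono mult_left_mono walk_vector_edge) (auto simp: degree_in_def)
  finally show ?thesis by (simp add: G_def)
qed

text \<open>If every start failed, so would the degree-weighted sum over all starts.\<close>

lemma exists_walk_vector:
  assumes ne: "S \<noteq> {}" and d: "d \<ge> 2" and avg: "d * real (card S) \<le> (\<Sum>u\<in>S. deg u)"
  shows "\<exists>v \<in> S. quad_form S E (walk_vector R v)
    \<ge> 2 * sqrt (d - 1) * cos (pi / (real R + 2)) * (\<Sum>u\<in>S. (walk_vector R v u)\<^sup>2)"
proof (rule ccontr)
  let ?c = "2 * sqrt (d - 1) * cos (pi / (real R + 2))"
  let ?M = "\<Sum>u\<in>S. deg u"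
  assume "\<not> (\<exists>v\<in>S. ?c * (\<Sum>u\<in>S. (walk_vector R v u)\<^sup>2) \<le> quad_form S E (walk_vector R v))"
  then have "quad_form S E (walk_vector R v) < ?c * (\<Sum>u\<in>S. (walk_vector R v u)\<^sup>2)" if "v \<in> S" for v
    using that by (auto simp: not_le)
  then have "(\<Sum>v\<in>S. deg v * quad_form S E (walk_vector R v))
      < (\<Sum>v\<in>S. deg v * (?c * (\<Sum>u\<in>S. (walk_vector R v u)\<^sup>2)))"
    using ne fin min_degree by (intro sum_strict_mono mult_strict_left_mono) (auto dest: min_degree)
  also have "\<dots> = ?c * (\<Sum>v\<in>S. deg v * (\<Sum>u\<in>S. (walk_vector R v u)\<^sup>2))"
    by (simp only: sum_distrib_left mult.left_commute[of "deg _"])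
  also have "\<dots> = sqrt (d - 1) * (2 * cos (pi / (real R + 2)) * (\<Sum>i\<le>R. (path_weight R i)\<^sup>2)) * ?M"
    by (simp add: walk_vector_weighted_norm)
  also have "\<dots> = 2 * (\<Sum>i<R. path_weight R i * path_weight R (Suc i)) * (sqrt (d - 1) * ?M)"
    by (simp add: path_weight_sum[symmetric])
  also have "\<dots> \<le> 2 * (\<Sum>i<R. path_weight R i * path_weight R (Suc i)) * (\<Sum>u\<in>S. deg u * sqrt (deg u - 1))"
  proof (intro mult_left_mono)
    \<comment> \<open>Tangent lines at \<open>d\<close> are summed over the vertices; the terms in
      \<open>deg u - d\<close> have a nonnegative sum because the average degree is at least
      \<open>d\<close>.\<close>
    have "sqrt (d - 1) * ?M \<le> sqrt (d - 1) * ?M + d / (2 * sqrt (d - 1)) * (?M - d * real (card S))"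
      using avg d by simp
    also have "?M - d * real (card S) = (\<Sum>u\<in>S. deg u - d)" by (simp add: sum_subtractf)
    also have "sqrt (d - 1) * ?M + d / (2 * sqrt (d - 1)) * (\<Sum>u\<in>S. deg u - d)
        = (\<Sum>u\<in>S. deg u * sqrt (d - 1) + d / (2 * sqrt (d - 1)) * (deg u - d))"
      by (simp only: sum.distrib sum_distrib_left mult.commute[of "sqrt (d - 1)"] sum_distrib_right)
    also have "\<dots> \<le> (\<Sum>u\<in>S. deg u * sqrt (deg u - 1))"
      using min_degree d by (intro sum_mono mult_sqrt_pred_tangent) (auto dest: min_degree)
    finally show "sqrt (d - 1) * ?M \<le> (\<Sum>u\<in>S. deg u * sqrt (deg u - 1))" .
    show "0 \<le> 2 * (\<Sum>i<R. path_weight R i * path_weight R (Suc i))"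
      by (auto intro!: sum_nonneg mult_nonneg_nonneg less_imp_le[OF path_weight_pos])
  qed
  also have "\<dots> \<le> (\<Sum>v\<in>S. deg v * quad_form S E (walk_vector R v))"
    by (rule walk_vector_weighted_quad_form)
  finally show False by simp
qed

lemma walk_vector_support:
  assumes "v \<in> S" "u \<in> S" "walk_vector R v u \<noteq> 0"
  shows "u \<in> reach S E v R"
proof -
  have "(\<Sum>i\<le>R. (path_weight R i)\<^sup>2 * visit_prob i v u) \<noteq> 0"
    using assms(3) by (auto simp: walk_vector_def)
  then obtain i where i: "i \<in> {..R}" "(path_weight R i)\<^sup>2 * visit_prob i v u \<noteq> 0"
    by (rule sum.not_neutral_contains_not_neutral)
  then have "u \<in> reach S E v i" using visit_prob_support[OF assms(1,2), of i] by auto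
  then show ?thesis using reach_mono[of i R S E v] i(1) by auto
qed

lemma walk_vector_start:
  assumes v: "v \<in> S"
  shows "walk_vector R v v > 0"
proof -
  have "0 < (path_weight R 0)\<^sup>2 * visit_prob 0 v v" using path_weight_pos[of 0 R] by simp
  also have "\<dots> \<le> (\<Sum>i\<le>R. (path_weight R i)\<^sup>2 * visit_prob i v v)"
    by (rule member_le_sum) (auto intro!: mult_nonneg_nonneg visit_prob_nonneg v simp del: visit_prob.simps)
  finally show ?thesis by (simp add: walk_vector_def)
qed

end
end

section \<open>Local test vectors\<close>

context finite_simple_graph
begin

text \<open>Ordered adjacent pairs are sorted by the sides of the cut on which their ends lie; the
  two crossing classes have equal size by symmetry.\<close>

lemma degree_sum_split:
  assumes C: "C \<subseteq> S"
  shows "(\<Sum>u\<in>S. deg u) = (\<Sum>u\<in>C. degree_in C E u) + (\<Sum>u\<in>S - C. degree_in (S - C) E u)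
    + 2 * (\<Sum>u\<in>C. real (card {w \<in> S - C. E u w}))"
proof -
  let ?e = "\<lambda>A B. \<Sum>u\<in>A. \<Sum>w\<in>B. if E u w then 1 else 0 :: real"
  have card: "real (card {w \<in> B. E u w}) = (\<Sum>w\<in>B. if E u w then 1 else 0)" if "finite B" for B u
    using that by (simp add: sum.inter_filter[symmetric])
  have "?e S S = ?e (S - C) S + ?e C S" by (rule sum.subset_diff[OF C fin])
  moreover have "?e A S = ?e A (S - C) + ?e A C" for A
    by (simp only: sum.subset_diff[OF C fin] sum.distrib)
  moreover have "?e (S - C) C = ?e C (S - C)"
    by (subst sum.swap) (intro sum.cong refl, auto dest: sym)
  moreover have "finite C" "finite (S - C)" using C fin by (auto intro: finite_subset)
  ultimately show ?thesis by (simp only: degree_in_def card fin)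
qed

lemma sum_degree_remove_vertex:
  assumes "v \<in> S"
  shows "(\<Sum>u\<in>S. deg u) = (\<Sum>u\<in>S - {v}. degree_in (S - {v}) E u) + 2 * deg v"
proof -
  have "{w \<in> S - {v}. E v w} = {w \<in> S. E v w}" using irrefl by auto
  then show ?thesis using degree_sum_split[of "{v}"] assms irrefl by (simp add: degree_in_def)
qed

lemma quad_form_one: "quad_form S E (\<lambda>_. 1) = (\<Sum>u\<in>S. deg u)"
  by (simp add: quad_form_def degree_in_def)

text \<open>Going back from \<open>x\<close> one layer at a time: a predecessor in an earlier layer
  would bring \<open>x\<close> into an earlier layer as well.\<close>

lemma geodesic:
  assumes "x \<in> reach S E v i" "\<And>j. j < i \<Longrightarrow> x \<notin> reach S E v j"
  shows "\<exists>p. p 0 = v \<and> p i = x \<and> (\<forall>j\<le>i. p j \<in> reach S E v j \<and> (\<forall>k<j. p j \<notin> reach S E v k))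
    \<and> (\<forall>j<i. E (p j) (p (Suc j)))"
  using assms
proof (induction i arbitrary: x)
  case 0
  then show ?case by (intro exI[of _ "\<lambda>_. v"]) auto
next
  case (Suc i)
  then have "x \<notin> reach S E v i" by blast
  then obtain u where u: "u \<in> reach S E v i" "E u x" and x: "x \<in> S" using Suc.prems(1) by auto
  have "u \<notin> reach S E v j" if "j < i" for j
  proof
    assume "u \<in> reach S E v j"
    then have "x \<in> reach S E v (Suc j)" using u x by auto
    then show False using Suc.prems(2)[of "Suc j"] that by simp
  qed
  then obtain p where p: "p 0 = v" "p i = u" 
      "\<forall>j\<le>i. p j \<in> reach S E v j \<and> (\<forall>k<j. p j \<notin> reach S E v k)"
      "\<forall>j<i. E (p j) (p (Suc j))"
    using Suc.IH[OF u(1)] by blast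
  show ?case
    by (intro exI[of _ "p(Suc i := x)"]) (use p u Suc.prems in \<open>auto simp: le_Suc_eq less_Suc_eq\<close>)
qed

text \<open>As long as the balls grow, there is a geodesic with \<open>R + 1\<close> vertices, and
  it carries the top eigenvector of the path.\<close>

lemma exists_path_vector:
  assumes v: "v \<in> S" and grow: "\<And>i. i < R \<Longrightarrow> reach S E v (Suc i) \<noteq> reach S E v i"
  shows "\<exists>f. f v \<noteq> 0 \<and> (\<forall>u. f u \<noteq> 0 \<longrightarrow> u \<in> reach S E v R)
    \<and> quad_form S E f \<ge> 2 * cos (pi / (real R + 2)) * (\<Sum>u\<in>S. (f u)\<^sup>2)"
proof -
  have "\<exists>x. x \<in> reach S E v R \<and> (\<forall>j<R. x \<notin> reach S E v j)"
  proof (cases R)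
    case 0
    then show ?thesis by auto
  next
    case (Suc k)
    then obtain x where "x \<in> reach S E v R" "x \<notin> reach S E v k" using grow[of k] by auto
    then show ?thesis using Suc reach_mono[of _ k S E v] by (metis less_Suc_eq_le subsetD)
  qed
  then obtain p where p0: "p 0 = v"
    and pr: "\<And>j. j \<le> R \<Longrightarrow> p j \<in> reach S E v j" "\<And>j k. j \<le> R \<Longrightarrow> k < j \<Longrightarrow> p j \<notin> reach S E v k"
    and pE: "\<And>j. j < R \<Longrightarrow> E (p j) (p (Suc j))"
    using geodesic[of _ v R] by metis
  have inj: "inj_on p {..R}"
    by (rule linorder_inj_onI) (use pr in \<open>metis atMost_iff less_imp_le\<close>, auto)
  have pS: "p j \<in> S" if "j \<le> R" for j using pr(1)[OF that] reach_subset[OF v] by blast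
  define f where "f u = (if u \<in> p ` {..R} then path_weight R (inv_into {..R} p u) else 0)" for u
  have fp: "f (p i) = path_weight R i" if "i \<le> R" for i
    using that inj by (simp add: f_def)
  have f0: "f u \<ge> 0" for u
  proof (cases "u \<in> p ` {..R}")
    case True
    then obtain i where "i \<le> R" "u = p i" by auto
    then show ?thesis using fp path_weight_pos[of i R] by simp
  next
    case False
    then show ?thesis by (simp add: f_def)
  qed
  have "(\<Sum>u\<in>S. (f u)\<^sup>2) = (\<Sum>u\<in>p ` {..R}. (f u)\<^sup>2)"
    using pS by (intro sum.mono_neutral_right fin) (auto simp: f_def)
  also have "\<dots> = (\<Sum>i\<le>R. (path_weight R i)\<^sup>2)"
    by (simp add: sum.reindex[OF inj] fp)
  finally have norm: "(\<Sum>u\<in>S. (f u)\<^sup>2) = (\<Sum>i\<le>R. (path_weight R i)\<^sup>2)" .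
  let ?up = "\<lambda>i. (p i, p (Suc i))" and ?down = "\<lambda>i. (p (Suc i), p i)"
  have inj_up: "inj_on ?up {..<R}" and inj_down: "inj_on ?down {..<R}"
    using inj by (auto simp: inj_on_def)
  have disj: "?up ` {..<R} \<inter> ?down ` {..<R} = {}"
  proof -
    have False if "i < R" "j < R" "p i = p (Suc j)" "p (Suc i) = p j" for i j
    proof -
      have "i = Suc j" "Suc i = j" using that by (auto intro: inj_onD[OF inj])
      then show False by simp
    qed
    then show ?thesis by auto
  qed
  have "2 * cos (pi / (real R + 2)) * (\<Sum>u\<in>S. (f u)\<^sup>2)
      = (\<Sum>i<R. f (p i) * f (p (Suc i))) + (\<Sum>i<R. f (p (Suc i)) * f (p i))"
    unfolding norm path_weight_sum[symmetric] by (simp add: fp mult.commute)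
  also have "\<dots> = (\<Sum>(u, w)\<in>?up ` {..<R} \<union> ?down ` {..<R}. f u * f w)"
    by (subst sum.union_disjoint) (auto simp: disj sum.reindex[OF inj_up] sum.reindex[OF inj_down])
  \<comment> \<open>Further edges among the vertices of the geodesic can only increase the form,
    since \<open>f\<close> is nonnegative.\<close>
  also have "\<dots> \<le> (\<Sum>(u, w)\<in>Sigma S nbrs. f u * f w)"
    by (rule sum_mono2) (use fin pS pE sym f0 in \<open>auto simp: Suc_le_eq\<close>)
  also have "\<dots> = quad_form S E f"
    unfolding quad_form_def by (subst sum.Sigma) (use fin in auto)
  finally have "quad_form S E f \<ge> 2 * cos (pi / (real R + 2)) * (\<Sum>u\<in>S. (f u)\<^sup>2)" .
  moreover have "f v \<noteq> 0" using fp[of 0] p0 path_weight_pos[of 0 R] by simp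
  moreover have "u \<in> reach S E v R" if "f u \<noteq> 0" for u
    using that pr(1) reach_mono[of _ R S E v] by (auto simp: f_def split: if_splits)
  ultimately show ?thesis by blast
qed

text \<open>
  Here vertices of degree 1 cannot be excluded, but minimality forces connectedness, and
  \<open>sqrt (d - 1) \<le> 1\<close> makes a geodesic with \<open>R + 1\<close> vertices sufficient.
\<close>

lemma exists_local_vector_low_degree:
  assumes d: "1 \<le> d" "d \<le> 2" and ne: "S \<noteq> {}" and avg: "d * real (card S) \<le> (\<Sum>u\<in>S. deg u)"
    and minimal: "\<And>T. T \<subset> S \<Longrightarrow> T \<noteq> {} \<Longrightarrow> (\<Sum>u\<in>T. degree_in T E u) < d * real (card T)"
  shows "\<exists>v\<in>S. \<exists>f. f v \<noteq> 0 \<and> (\<forall>u. f u \<noteq> 0 \<longrightarrow> u \<in> reach S E v R)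
    \<and> quad_form S E f \<ge> 2 * sqrt (d - 1) * cos (pi / (real R + 2)) * (\<Sum>u\<in>S. (f u)\<^sup>2)"
proof -
  obtain v where v: "v \<in> S" using ne by blast
  have nonneg: "0 \<le> cos (pi / (real R + 2)) * (\<Sum>u\<in>S. (f u)\<^sup>2)" for f :: "'a \<Rightarrow> real"
    by (intro mult_nonneg_nonneg cos_pi_div_nonneg sum_nonneg) auto
  show ?thesis
  proof (cases "\<forall>i<R. reach S E v (Suc i) \<noteq> reach S E v i")
    case True
    then obtain f where f: "f v \<noteq> 0" "\<forall>u. f u \<noteq> 0 \<longrightarrow> u \<in> reach S E v R"
      "quad_form S E f \<ge> 2 * cos (pi / (real R + 2)) * (\<Sum>u\<in>S. (f u)\<^sup>2)"
      using exists_path_vector[OF v, of R] by blast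
    have "sqrt (d - 1) * (cos (pi / (real R + 2)) * (\<Sum>u\<in>S. (f u)\<^sup>2))
        \<le> 1 * (cos (pi / (real R + 2)) * (\<Sum>u\<in>S. (f u)\<^sup>2))"
      using d by (intro mult_right_mono nonneg) simp
    then show ?thesis using f v by (intro bexI[OF _ v] exI[of _ f]) (auto simp: ac_simps)
  next
    case False
    then obtain i where i: "i < R" "reach S E v (Suc i) = reach S E v i" by blast
    \<comment> \<open>The ball stopped growing before radius \<open>R\<close>, so no edge inside
      \<open>S\<close> leaves it.\<close>
    define C where "C = reach S E v i"
    have C: "C \<subseteq> S" "v \<in> C"
      using reach_subset[OF v] reach_mono[of 0 i S E v] by (auto simp: C_def)
    have "w \<in> C" if "u \<in> C" "w \<in> S" "E u w" for u w
    proof -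
      have "w \<in> reach S E v (Suc i)" using that by (auto simp: C_def)
      then show ?thesis by (simp only: i C_def)
    qed
    then have "{w \<in> S - C. E u w} = {}" if "u \<in> C" for u using that by blast
    then have "(\<Sum>u\<in>C. real (card {w \<in> S - C. E u w})) = 0" by (intro sum.neutral ballI) (simp only: card.empty of_nat_0)
    then have split: "(\<Sum>u\<in>S. deg u) = (\<Sum>u\<in>C. degree_in C E u) + (\<Sum>u\<in>S - C. degree_in (S - C) E u)"
      using degree_sum_split[OF C(1)] by linarith
    \<comment> \<open>Otherwise \<open>C\<close> and its complement are both too sparse by
      minimality, and with no edges between them \<open>S\<close> would be too sparse too.\<close>
    have "C = S"
    proof (rule ccontr)
      assume "C \<noteq> S"
      then have "(\<Sum>u\<in>C. degree_in C E u) < d * real (card C)"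
        "(\<Sum>u\<in>S - C. degree_in (S - C) E u) < d * real (card (S - C))"
        using C by (auto intro!: minimal)
      then have "(\<Sum>u\<in>S. deg u) < d * (real (card C) + real (card (S - C)))"
        unfolding split by (simp add: distrib_left)
      also have "real (card C) + real (card (S - C)) = real (card S)"
        using C(1) fin by (metis card_Diff_subset card_mono finite_subset le_add_diff_inverse of_nat_add)
      finally show False using avg by simp
    qed
    then have all: "reach S E v R = S"
      using i reach_mono[of i R S E v] reach_subset[OF v, of E R] by (auto simp: C_def)
    \<comment> \<open>The ball of radius \<open>R\<close> is all of \<open>S\<close>, so the
      indicator of \<open>S\<close> is a local vector; its Rayleigh quotient is the average
      degree.\<close>
    let ?f = "\<lambda>u. if u \<in> S then 1 else 0 :: real"
    have "2 * sqrt (d - 1) * cos (pi / (real R + 2)) * real (card S) \<le> d * real (card S)"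
      using two_sqrt_pred_cos_le[OF d(1)] by (intro mult_right_mono) auto
    moreover have "quad_form S E ?f = quad_form S E (\<lambda>_. 1)"
      unfolding quad_form_def by (intro sum.cong refl) auto
    ultimately have "quad_form S E ?f \<ge> 2 * sqrt (d - 1) * cos (pi / (real R + 2)) * (\<Sum>u\<in>S. (?f u)\<^sup>2)"
      using avg quad_form_one by simp
    then show ?thesis using v all by (intro bexI[OF _ v] exI[of _ ?f]) auto
  qed
qed

lemma quad_form_superset:
  assumes "T \<subseteq> S" "\<And>u. u \<notin> T \<Longrightarrow> f u = 0"
  shows "quad_form S E f = quad_form T E f"
proof -
  have "quad_form S E f = (\<Sum>u\<in>T. \<Sum>w\<in>nbrs u. f u * f w)"
    unfolding quad_form_def using assms fin by (intro sum.mono_neutral_right) auto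
  also have "\<dots> = quad_form T E f"
    unfolding quad_form_def using assms fin by (intro sum.cong refl sum.mono_neutral_right) auto
  finally show ?thesis .
qed

text \<open>In a smallest dense subset \<open>T\<close> the geodesic argument covers
  \<open>d \<le> 2\<close> and the random walk covers \<open>d > 2\<close>. The result passes to
  \<open>S\<close> because balls within \<open>T\<close> lie in balls within
  \<open>S\<close>.\<close>

lemma exists_local_vector:
  assumes d: "1 \<le> d" and ne: "S \<noteq> {}" and avg: "d * real (card S) \<le> (\<Sum>u\<in>S. deg u)"
  shows "\<exists>v\<in>S. \<exists>f. f v \<noteq> 0 \<and> (\<forall>u. f u \<noteq> 0 \<longrightarrow> u \<in> reach S E v R)
    \<and> quad_form S E f \<ge> 2 * sqrt (d - 1) * cos (pi / (real R + 2)) * (\<Sum>u\<in>S. (f u)\<^sup>2)"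
proof -
  \<comment> \<open>Minimality of a dense vertex set forces every degree to exceed \<open>d / 2\<close>.\<close>
  define dense where "dense T \<longleftrightarrow> T \<subseteq> S \<and> T \<noteq> {} \<and> d * real (card T) \<le> (\<Sum>u\<in>T. degree_in T E u)" for T
  have "dense S" using ne avg by (simp add: dense_def)
  then obtain T where T: "dense T" and least: "\<And>U. dense U \<Longrightarrow> card T \<le> card U"
    using ex_has_least_nat[of dense S card] by blast
  have TS: "T \<subseteq> S" and Tne: "T \<noteq> {}" and Tavg: "d * real (card T) \<le> (\<Sum>u\<in>T. degree_in T E u)"
    using T by (auto simp: dense_def)
  interpret T: finite_simple_graph T E
    by standard (use fin TS finite_subset sym irrefl in auto)
  have minimal: "(\<Sum>u\<in>U. degree_in U E u) < d * real (card U)" if "U \<subset> T" "U \<noteq> {}" for U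
  proof (rule ccontr)
    assume "\<not> ?thesis"
    then have "dense U" using that TS by (auto simp: dense_def)
    then show False using least[of U] psubset_card_mono[OF T.fin that(1)] by simp
  qed
  have "\<exists>v\<in>T. \<exists>f. f v \<noteq> 0 \<and> (\<forall>u. f u \<noteq> 0 \<longrightarrow> u \<in> reach T E v R)
    \<and> quad_form T E f \<ge> 2 * sqrt (d - 1) * cos (pi / (real R + 2)) * (\<Sum>u\<in>T. (f u)\<^sup>2)"
  proof (cases "d \<le> 2")
    case True
    then show ?thesis using T.exists_local_vector_low_degree[OF d _ Tne Tavg minimal] by blast
  next
    case False
    have deg2: "degree_in T E v \<ge> 2" if v: "v \<in> T" for v
    proof -
      have "T - {v} \<noteq> {}"
      proof
        assume "T - {v} = {}"
        then have "T = {v}" using v by auto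
        moreover have "degree_in {v} E v = 0" using irrefl by (auto simp: degree_in_def)
        ultimately show False using Tavg d by simp
      qed
      then have "(\<Sum>u\<in>T - {v}. degree_in (T - {v}) E u) < d * real (card (T - {v}))"
        using v by (intro minimal) auto
      moreover have "real (card T) = real (card (T - {v})) + 1"
        using card_Suc_Diff1[OF T.fin v] by linarith
      \<comment> \<open>Deleting \<open>v\<close> lowers the degree sum by
        \<open>2 * degree_in T E v\<close>, which must exceed \<open>d > 2\<close>; being an
        integer, the degree is then at least 2.\<close>
      ultimately have "degree_in T E v > 1"
        using T.sum_degree_remove_vertex[OF v] Tavg False by (simp add: distrib_left)
      then show ?thesis by (simp add: degree_in_def)
    qed
    have d2: "d \<ge> 2" using False by simp
    obtain v where v: "v \<in> T" and q: "quad_form T E (T.walk_vector R v)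
       \<ge> 2 * sqrt (d - 1) * cos (pi / (real R + 2)) * (\<Sum>u\<in>T. (T.walk_vector R v u)\<^sup>2)"
      using T.exists_walk_vector[OF deg2 Tne d2 Tavg, of R] by blast
    \<comment> \<open>The support of the walk vector is controlled only at vertices of
      \<open>T\<close>, so it is set to 0 elsewhere.\<close>
    let ?f = "\<lambda>u. if u \<in> T then T.walk_vector R v u else 0"
    have "quad_form T E ?f = quad_form T E (T.walk_vector R v)"
      unfolding quad_form_def by (intro sum.cong refl) auto
    moreover have "?f v \<noteq> 0" using T.walk_vector_start[OF deg2 v, of R] v by simp
    moreover have "u \<in> reach T E v R" if "?f u \<noteq> 0" for u
      using that T.walk_vector_support[OF deg2 v] by (auto split: if_splits)
    ultimately show ?thesis using q v by (intro bexI[OF _ v] exI[of _ ?f]) simp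
  qed
  then obtain v f where v: "v \<in> T" "f v \<noteq> 0" and supp: "\<And>u. f u \<noteq> 0 \<Longrightarrow> u \<in> reach T E v R"
    and q: "quad_form T E f \<ge> 2 * sqrt (d - 1) * cos (pi / (real R + 2)) * (\<Sum>u\<in>T. (f u)\<^sup>2)"
    by (elim bexE exE conjE) blast
  have zero: "f u = 0" if "u \<notin> T" for u using supp[of u] that reach_subset[OF v(1), of E R] by auto
  have "(\<Sum>u\<in>S. (f u)\<^sup>2) = (\<Sum>u\<in>T. (f u)\<^sup>2)"
    using zero TS fin by (intro sum.mono_neutral_right) auto
  then show ?thesis
    using v supp q TS reach_mono_set[OF TS, of E v R] quad_form_superset[OF TS zero]
    by (intro bexI[of _ v] exI[of _ f]) auto
qed

end

section \<open>Adjacency matrices and balls\<close>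

text \<open>Forgetting the order of a pair is a map with fibres of size two, by symmetry and the
  absence of loops.\<close>

lemma double_card_edge_set:
  assumes fin: "finite (arcs_ends G)" and sym: "sym (arcs_ends G)" and irrefl: "\<And>u. (u, u) \<notin> arcs_ends G"
  shows "2 * card (edge_set G) = card (arcs_ends G)"
proof -
  let ?A = "arcs_ends G"
  let ?f = "\<lambda>(u, w). {u, w}"
  have edges: "edge_set G = ?f ` ?A" by (auto simp: edge_set_def)
  have fibre: "card {p \<in> ?A. ?f p = e} = 2" if e: "e \<in> ?f ` ?A" for e
  proof -
    obtain u w where uw: "(u, w) \<in> ?A" "e = {u, w}" using e by auto
    then have "{p \<in> ?A. ?f p = e} = {(u, w), (w, u)}"
      using sym by (auto simp: doubleton_eq_iff dest: symD)
    moreover have "u \<noteq> w" using uw irrefl by auto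
    ultimately show ?thesis by simp
  qed
  have "card ?A = (\<Sum>e\<in>?f ` ?A. card {p \<in> ?A. ?f p = e})"
    using sum.image_gen[OF fin, of "\<lambda>_. 1 :: nat" ?f] by simp
  then show ?thesis by (simp add: edges fibre)
qed

section \<open>From the graph locale to vertex sets with an adjacency relation\<close>

context graph
begin

abbreviation adjacent :: "'a \<Rightarrow> 'a \<Rightarrow> bool" where
  "adjacent u w \<equiv> (u, w) \<in> arcs_ends G"

lemma finite_simple_graph_subset: "T \<subseteq> verts G \<Longrightarrow> finite_simple_graph T adjacent"
  using sym_arcs no_loops
  by unfold_locales (auto intro: finite_subset simp: symmetric_def arcs_ends_conv dest: symD)

lemma average_degree_induced:
  assumes T: "T \<subseteq> verts G" and d: "d > 0" "average_degree (G \<restriction> T) \<ge> d"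
  shows "T \<noteq> {}" "d * real (card T) \<le> (\<Sum>u\<in>T. degree_in T adjacent u)"
proof -
  have finT: "finite T" using T by (rule finite_subset) simp
  have ends: "arcs_ends (G \<restriction> T) = Sigma T (\<lambda>u. {w \<in> T. adjacent u w})"
    by (auto simp: arcs_ends_conv)
  interpret T: finite_simple_graph T adjacent by (rule finite_simple_graph_subset[OF T])
  have "2 * card (edge_set (G \<restriction> T)) = card (arcs_ends (G \<restriction> T))"
    by (rule double_card_edge_set) (auto simp: ends finT T.irrefl intro!: symI dest: T.sym)
  then have "real (2 * card (edge_set (G \<restriction> T))) = real (\<Sum>u\<in>T. card {w \<in> T. adjacent u w})"
    by (simp add: ends finT)
  then have sum: "2 * real (card (edge_set (G \<restriction> T))) = (\<Sum>u\<in>T. degree_in T adjacent u)"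
    by (simp add: degree_in_def)
  \<comment> \<open>The empty graph has average degree 0 by the convention for division by zero,
    which is below \<open>d\<close>.\<close>
  show ne: "T \<noteq> {}" using d by (auto simp: average_degree_def)
  then have "card T > 0" using finT by (simp add: card_gt_0_iff)
  then show "d * real (card T) \<le> (\<Sum>u\<in>T. degree_in T adjacent u)"
    using d(2) by (simp add: average_degree_def sum pos_le_divide_eq)
qed

text \<open>Each new layer appends one arc to a walk, and the distance is at most the length of any
  walk.\<close>

lemma reach_imp_graph_dist_le:
  assumes "v \<in> verts G" "u \<in> reach (verts G) adjacent v i"
  shows "graph_dist G v u \<le> ereal (real i)"
proof -
  have "\<exists>p. awalk v p u \<and> length p \<le> i"
    using assms(2)
  proof (induction i arbitrary: u)
    case 0
    then show ?case using assms(1) by (intro exI[of _ "[]"]) (auto simp: awalk_Nil_iff)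
  next
    case (Suc i)
    show ?case
    proof (cases "u \<in> reach (verts G) adjacent v i")
      case True
      then show ?thesis using Suc.IH le_SucI by blast
    next
      case False
      then obtain w where w: "w \<in> reach (verts G) adjacent v i" "adjacent w u" using Suc.prems by auto
      then obtain p e where p: "awalk v p w" "length p \<le> i" and e: "e \<in> arcs G" "tail G e = w" "head G e = u"
        using Suc.IH by (fastforce simp: arcs_ends_conv)
      have "awalk v (p @ [e]) u" using p(1) e by (auto intro!: awalk_appendI arc_implies_awalk)
      then show ?thesis using p(2) by (intro exI[of _ "p @ [e]"]) simp
    qed
  qed
  then obtain p where p: "awalk v p u" "length p \<le> i" by blast
  have "awalk_cost (\<lambda>_. 1) p = real (length p)" by (induction p) (auto simp: awalk_cost_def)
  then show ?thesis
    using min_cost_le_walk_cost[OF p(1), of "\<lambda>_. 1"] p(2) unfolding graph_dist_def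
    by (metis ereal_less_eq(3) of_nat_le_iff order_trans)
qed

lemma reach_subset_graph_ball:
  assumes "v \<in> verts G"
  shows "reach (verts G) adjacent v r \<subseteq> verts (graph_ball G v r)"
proof
  fix u assume "u \<in> reach (verts G) adjacent v r"
  then show "u \<in> verts (graph_ball G v r)"
    using reach_imp_graph_dist_le[OF assms] reach_subset[OF assms, of adjacent r]
    by (auto simp: graph_ball_def)
qed

text \<open>The separation condition kills all cross terms, so on the span of \<open>f\<close> and
  \<open>h\<close> both the norm and the form are diagonal in the coefficients \<open>a\<close> and
  \<open>b\<close>.\<close>

lemma lambda2_ge:
  assumes f: "quad_form (verts G) adjacent f \<ge> c * (\<Sum>u\<in>verts G. (f u)\<^sup>2)" "u0 \<in> verts G" "f u0 \<noteq> 0"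
    and h: "quad_form (verts G) adjacent h \<ge> c * (\<Sum>u\<in>verts G. (h u)\<^sup>2)" "w0 \<in> verts G" "h w0 \<noteq> 0"
    and sep: "\<And>u w. u = w \<or> adjacent u w \<Longrightarrow> f u * h w = 0"
  shows "lambda2 G \<ge> c"
proof -
  let ?V = "verts G"
  interpret V: finite_simple_graph ?V adjacent by (rule finite_simple_graph_subset) simp
  define vs where "vs = vertex_enumeration G"
  have vs: "distinct vs" "set vs = ?V"
    using someI_ex[of "\<lambda>vs. distinct vs \<and> set vs = ?V"] finite_distinct_list[of ?V]
    by (auto simp: vs_def vertex_enumeration_def)
  define n where "n = length vs"
  define A where "A = adjacency_matrix G vs"
  define X where "X k = vec n (\<lambda>i. k (vs ! i))" for k :: "'a \<Rightarrow> real"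
  have reindex: "(\<Sum>i = 0..<n. k (vs ! i)) = (\<Sum>u\<in>?V. k u)" for k :: "'a \<Rightarrow> real"
    using sum.reindex_bij_betw[OF bij_betw_nth[OF vs(1) refl refl], of k] vs(2)
    by (simp add: n_def atLeast0LessThan)
  have A: "A \<in> carrier_mat n n" by (simp add: A_def adjacency_matrix_def n_def)
  have AT: "A\<^sup>T = A"
    by (intro eq_matI) (auto simp: A_def adjacency_matrix_def dest: V.sym)
  have X: "X k \<in> carrier_vec n" for k by (simp add: X_def)
  have norm: "X k \<bullet> X k = (\<Sum>u\<in>?V. (k u)\<^sup>2)" for k
    using reindex[of "\<lambda>u. (k u)\<^sup>2"] by (simp add: X_def scalar_prod_def power2_eq_square)
  have form: "X k \<bullet> (A *\<^sub>v X k) = quad_form ?V adjacent k" for k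
  proof -
    have "X k \<bullet> (A *\<^sub>v X k) = (\<Sum>i = 0..<n. k (vs ! i) * (\<Sum>j = 0..<n.
        (if adjacent (vs ! i) (vs ! j) then 1 else 0) * k (vs ! j)))"
      by (simp add: X_def A_def adjacency_matrix_def scalar_prod_def n_def)
    also have "\<dots> = (\<Sum>i = 0..<n. k (vs ! i) * (\<Sum>w\<in>?V. (if adjacent (vs ! i) w then 1 else 0) * k w))"
      by (intro sum.cong refl arg_cong2[where f="(*)"] reindex)
    also have "\<dots> = (\<Sum>u\<in>?V. k u * (\<Sum>w\<in>?V. (if adjacent u w then 1 else 0) * k w))"
      by (rule reindex)
    also have "\<dots> = quad_form ?V adjacent k"
      unfolding quad_form_def sum_distrib_left
    proof (rule sum.cong[OF refl])
      fix u
      have "(\<Sum>w\<in>?V. k u * ((if adjacent u w then 1 else 0) * k w))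
          = (\<Sum>w\<in>?V. if adjacent u w then k u * k w else 0)" by (intro sum.cong) auto
      also have "\<dots> = (\<Sum>w\<in>V.nbrs u. k u * k w)" by (rule sum.inter_filter[symmetric]) simp
      finally show "(\<Sum>w\<in>?V. k u * ((if adjacent u w then 1 else 0) * k w))
          = (\<Sum>w\<in>V.nbrs u. k u * k w)" .
    qed
    finally show ?thesis .
  qed
  have comb: "a \<cdot>\<^sub>v X f + b \<cdot>\<^sub>v X h = X (\<lambda>u. a * f u + b * h u)" for a b
    by (intro eq_vecI) (auto simp: X_def)
  have fh: "f u * h u = 0" for u using sep[of u u] by simp
  have norm_comb: "(\<Sum>u\<in>?V. (a * f u + b * h u)\<^sup>2)
      = a\<^sup>2 * (\<Sum>u\<in>?V. (f u)\<^sup>2) + b\<^sup>2 * (\<Sum>u\<in>?V. (h u)\<^sup>2)" for a b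
  proof -
    have "(a * f u + b * h u)\<^sup>2 = a\<^sup>2 * (f u)\<^sup>2 + b\<^sup>2 * (h u)\<^sup>2" for u
      using fh[of u] by (auto simp: power2_eq_square)
    then show ?thesis by (simp add: sum.distrib sum_distrib_left)
  qed
  have form_comb: "quad_form ?V adjacent (\<lambda>u. a * f u + b * h u)
      = a\<^sup>2 * quad_form ?V adjacent f + b\<^sup>2 * quad_form ?V adjacent h" for a b
  proof -
    have "(a * f u + b * h u) * (a * f w + b * h w) = a\<^sup>2 * (f u * f w) + b\<^sup>2 * (h u * h w)"
      if "adjacent u w" for u w
    proof -
      have "f u * h w = 0" "h u * f w = 0"
        using sep[of u w] sep[of w u] V.sym[OF that] that by (simp_all add: mult.commute)
      then show ?thesis by (auto simp: power2_eq_square algebra_simps)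
    qed
    then show ?thesis by (simp add: quad_form_def sum.distrib sum_distrib_left)
  qed
  have fpos: "(\<Sum>u\<in>?V. (f u)\<^sup>2) > 0" using f by (intro sum_pos2[of _ u0]) auto
  have hpos: "(\<Sum>u\<in>?V. (h u)\<^sup>2) > 0" using h by (intro sum_pos2[of _ w0]) auto
  \<comment> \<open>Disjoint supports give two distinct vertices, so the eigenvalue list has an
    entry at index 1.\<close>
  have "u0 \<noteq> w0" using fh[of u0] f(3) h(3) by (metis mult_eq_0_iff)
  then have "card {u0, w0} \<le> card ?V" using f h by (intro card_mono) auto
  then have "n \<ge> 2" using \<open>u0 \<noteq> w0\<close> vs distinct_card[OF vs(1)] by (simp add: n_def)
  then have "c \<le> rev (sorted_list_of_multiset (proots (char_poly A))) ! 1"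
  proof (rule second_eigenvalue_ge[OF A AT _ X X])
    fix a b :: real
    show "c * ((a \<cdot>\<^sub>v X f + b \<cdot>\<^sub>v X h) \<bullet> (a \<cdot>\<^sub>v X f + b \<cdot>\<^sub>v X h))
        \<le> (a \<cdot>\<^sub>v X f + b \<cdot>\<^sub>v X h) \<bullet> (A *\<^sub>v (a \<cdot>\<^sub>v X f + b \<cdot>\<^sub>v X h))"
      unfolding comb norm form norm_comb form_comb
      using mult_left_mono[OF f(1), of "a\<^sup>2"] mult_left_mono[OF h(1), of "b\<^sup>2"]
      by (simp add: algebra_simps)
    assume ab: "a \<noteq> 0 \<or> b \<noteq> 0"
    have "0 < a\<^sup>2 * (\<Sum>u\<in>?V. (f u)\<^sup>2) + b\<^sup>2 * (\<Sum>u\<in>?V. (h u)\<^sup>2)"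
    proof (cases "a = 0")
      case True
      then show ?thesis using ab hpos by simp
    next
      case False
      then show ?thesis using fpos hpos by (intro add_pos_nonneg mult_pos_pos mult_nonneg_nonneg) auto
    qed
    then show "0 < (a \<cdot>\<^sub>v X f + b \<cdot>\<^sub>v X h) \<bullet> (a \<cdot>\<^sub>v X f + b \<cdot>\<^sub>v X h)"
      unfolding comb norm norm_comb .
  qed
  then show ?thesis by (simp add: lambda2_def graph_eigenvalues_def A_def vs_def)
qed

end

theorem theorem4:
  fixes G :: "('a, 'b) pre_digraph" and d :: real and r :: nat
  assumes "graph G"
    and "verts G \<noteq> {}"
    and "d \<ge> 1"
    and "r \<ge> 1"
    and "robust_average_degree_ge G r d"
  shows "lambda2 G \<ge> 2 * sqrt (d - 1) * cos (pi / (real r + 1))"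
proof -
  interpret graph G by fact
  let ?V = "verts G"
  interpret V: finite_simple_graph ?V adjacent by (rule finite_simple_graph_subset) simp
  \<comment> \<open>The path has \<open>R + 1 = r\<close> vertices, which gives the angle
    \<open>pi / (r + 1)\<close>, and radius \<open>R\<close> leaves room for one more step inside a
    ball of radius \<open>r\<close>.\<close>
  define R where "R = r - 1"
  have R: "r = Suc R" "real r + 1 = real R + 2" using \<open>r \<ge> 1\<close> by (simp_all add: R_def)
  let ?c = "2 * sqrt (d - 1) * cos (pi / (real r + 1))"
  have avg: "average_degree (G \<restriction> (?V - verts (graph_ball G v r))) \<ge> d" if "v \<in> ?V" for v
    using assms(5) that by (simp add: robust_average_degree_ge_def)
  have dpos: "d > 0" using \<open>d \<ge> 1\<close> by simp
  obtain v0 where v0: "v0 \<in> ?V" using \<open>?V \<noteq> {}\<close> by blast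
  \<comment> \<open>The hypothesis bounds average degrees only after a ball is deleted, so the local
    vector is sought in such a remainder.\<close>
  let ?T = "?V - verts (graph_ball G v0 r)"
  interpret T: finite_simple_graph ?T adjacent by (rule finite_simple_graph_subset) auto
  obtain v f where v: "v \<in> ?T" "f v \<noteq> 0" and supp: "\<And>u. f u \<noteq> 0 \<Longrightarrow> u \<in> reach ?T adjacent v R"
    and q: "quad_form ?T adjacent f \<ge> ?c * (\<Sum>u\<in>?T. (f u)\<^sup>2)"
    using T.exists_local_vector[OF \<open>d \<ge> 1\<close> average_degree_induced[OF _ dpos avg[OF v0]], of R]
    unfolding R(2) by blast
  have vV: "v \<in> ?V" using v by blast
  have zero: "f u = 0" if "u \<notin> ?T" for u using supp[of u] that reach_subset[OF v(1), of adjacent R] by auto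
  have suppV: "u \<in> reach ?V adjacent v R" if "f u \<noteq> 0" for u
    using supp[OF that] reach_mono_set[of ?T ?V adjacent v R] by blast
  let ?U = "?V - verts (graph_ball G v r)"
  interpret U: finite_simple_graph ?U adjacent by (rule finite_simple_graph_subset) auto
  have Une: "?U \<noteq> {}" and Uavg: "d * real (card ?U) \<le> (\<Sum>u\<in>?U. degree_in ?U adjacent u)"
    using average_degree_induced[OF _ dpos avg[OF vV]] by blast+
  \<comment> \<open>The form of this indicator counts the degrees inside \<open>?U\<close>, so its
    Rayleigh quotient is the average degree there.\<close>
  define h where "h u = (if u \<in> ?U then 1 else 0 :: real)" for u
  obtain w0 where w0: "w0 \<in> ?U" using Une by blast
  show ?thesis
  proof (rule lambda2_ge[of _ f v h w0])
    have "(\<Sum>u\<in>?V. (f u)\<^sup>2) = (\<Sum>u\<in>?T. (f u)\<^sup>2)"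
      using zero by (intro sum.mono_neutral_right) auto
    then show "?c * (\<Sum>u\<in>?V. (f u)\<^sup>2) \<le> quad_form ?V adjacent f"
      using q V.quad_form_superset[of ?T f, OF _ zero] by auto
    have "quad_form ?V adjacent h = quad_form ?U adjacent h"
      by (rule V.quad_form_superset) (auto simp: h_def)
    also have "\<dots> = quad_form ?U adjacent (\<lambda>_. 1)"
      unfolding quad_form_def by (intro sum.cong refl) (auto simp: h_def)
    finally have qh: "quad_form ?V adjacent h = (\<Sum>u\<in>?U. degree_in ?U adjacent u)"
      by (simp only: U.quad_form_one)
    have "(\<Sum>u\<in>?V. (h u)\<^sup>2) = (\<Sum>u\<in>?U. (h u)\<^sup>2)"
      by (intro sum.mono_neutral_right) (auto simp: h_def)
    also have "\<dots> = (\<Sum>u\<in>?U. 1)" by (intro sum.cong refl) (simp add: h_def)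
    finally have nh: "(\<Sum>u\<in>?V. (h u)\<^sup>2) = real (card ?U)" by simp
    have "?c \<le> d" unfolding R(2) by (rule two_sqrt_pred_cos_le) fact
    then show "?c * (\<Sum>u\<in>?V. (h u)\<^sup>2) \<le> quad_form ?V adjacent h"
      unfolding qh nh using Uavg mult_right_mono[of ?c d "real (card ?U)"] by linarith
    \<comment> \<open>A vertex equal or adjacent to one within \<open>R\<close> steps of
      \<open>v\<close> is within \<open>R + 1 = r\<close> steps, hence in the ball removed to form
      \<open>?U\<close>.\<close>
    show "f u * h w = 0" if "u = w \<or> adjacent u w" for u w
    proof (rule ccontr)
      assume "f u * h w \<noteq> 0"
      then have "u \<in> reach ?V adjacent v R" and w: "w \<in> ?U"
        using suppV by (auto simp: h_def split: if_splits)
      then have "w \<in> reach ?V adjacent v r" using that by (auto simp: R(1))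
      then show False using w reach_subset_graph_ball[OF vV, of r] by blast
    qed
    show "h w0 \<noteq> 0" using w0 by (simp add: h_def)
  qed (use v vV w0 in auto)
qed

end
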